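(* Let $p\in(1,\infty)$. If $\nu$ satisfies the $(\alpha,p)$ Frostman condition and $W$ satisfies the second structural condition, then the mapping $I_\alpha\colon\mathfrak{W}\to L_p(\nu)$ is continuous.
   Context: Fix integers $m\ge 3$ and $\ell\ge 1$. Consider a probability space with an $m$-uniform filtration $\mathcal{F}=\{\mathcal{F}_n\}_{n\ge0}$: $\mathcal{F}_0$ is trivial, each $\mathcal{F}_n$ is a finite algebra with set of atoms $\mathcal{AF}_n$, and each atom in $\mathcal{F}_n$ is split into $m$ atoms of $\mathcal{F}_{n+1}$ (its children) of equal probability. The probability space is identified with the compact metric space $\mathbb{T}$ of infinite paths $\gamma=(\gamma(0)\supset\gamma(1)\supset\cdots)$, $\gamma(n)\in\mathcal{AF}_n$, in the tree of atoms, with $\mathrm{dist}(\gamma_1,\gamma_2)=m^{-d}$, $d=\max\{n : \gamma_1(j)=\gamma_2(j)\text{ for all }j<n\}$ for $\gamma_1\ne\gamma_2$; an atom $\omega\in\mathcal{AF}_n$ is identified with the cylinder $\{\gamma : \gamma(n)=\omega\}$, of probability $m^{-n}$, so $\mathcal{F}_n$-measurable functions are defined pointwise on $\mathbb{T}$. The norm $\|\cdot\|$ on $\mathbb{R}^\ell$ is Euclidean. Let $V=\{v\in\mathbb{R}^m : \sum_{j=1}^m v_j=0\}$. Elements of $V^\ell$ are identified with $m$-tuples $\{b_j\}_{j=1}^m$ of vectors $b_j\in\mathbb{R}^\ell$ with $\sum_j b_j=0$; for $v\in V$, $a\in\mathbb{R}^\ell$, $v\otimes a=\{v_j a\}_{j=1}^m$.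 For each $n$ and $\omega\in\mathcal{AF}_n$ fix a bijection $J_\omega$ from $\{1,\dots,m\}$ onto the set of children of $\omega$; for $b\in V^\ell$ let $J_\omega[b]$ be the function on $\omega$ equal to $b_j$ on the child $J_\omega(j)$. Let $W$ be a linear subspace of $V^\ell$. With $f_{n+1}=F_{n+1}-F_n$, let $\mathfrak{W}$ be the space of $\mathbb{R}^\ell$-valued martingales $F=\{F_n\}_{n\ge0}$ adapted to $\mathcal{F}$ with $\|F\|_{\mathfrak{W}}=\sup_n\mathbb{E}\|F_n\|<\infty$ and $f_{n+1}|_\omega\in J_\omega[W]$ for all $n\ge0$, $\omega\in\mathcal{AF}_n$. Second structural condition on $W$: $W$ contains no non-zero vector $v\otimes a$ with $a\in\mathbb{R}^\ell$ and $v\in V$ having $m-1$ equal coordinates. For $\alpha\in\mathbb{R}$, $I_\alpha[F]=\sum_{n\ge1}m^{-\alpha n}f_n$. Continuity of $I_\alpha\colon\mathfrak{W}\to L_p(\nu)$ means that this series converges in $L_p(\nu)$ for every $F\in\mathfrak{W}$ and $\|I_\alpha[F]\|_{L_p(\nu)}\le C\|F\|_{\mathfrak{W}}$ with $C$ independent of $F$. A finite non-negative Borel measure $\nu$ on $\mathbb{T}$ satisfies the $(\alpha,p)$ Frostman condition if there is a constant $C$ with $(\nu(\omega))^{1/p}\le C m^{(\alpha-1)n}$ for all $n\ge0$ and all $\omega\in\mathcal{AF}_n$. *)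

theory Defs
  imports "HOL-Probability.Probability"
begin

section \<open>Uniform filtrations and the tree of atoms\<close>

definition atoms :: "'a measure \<Rightarrow> 'a set set" where
  "atoms N = {A \<in> sets N. A \<noteq> {} \<and> (\<forall>B\<in>sets N. B \<subseteq> A \<longrightarrow> B = {} \<or> B = A)}"

definition children :: "(nat \<Rightarrow> 'a measure) \<Rightarrow> nat \<Rightarrow> 'a set \<Rightarrow> 'a set set" where
  "children \<F> n \<omega> = {\<eta> \<in> atoms (\<F> (Suc n)). \<eta> \<subseteq> \<omega>}"

text \<open>
  The algebras are given as measures of which only the space and the measurable sets matter, as
  in \<^locale>\<open>filtration\<close> and \<^const>\<open>subalgebra\<close>.
\<close>

definition m_uniform_filtration :: "nat \<Rightarrow> 'a measure \<Rightarrow> (nat \<Rightarrow> 'a measure) \<Rightarrow> bool" where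
  "m_uniform_filtration m M \<F> \<longleftrightarrow>
     prob_space M \<and>
     filtration (space M) \<F> \<and>
     (\<forall>n. subalgebra M (\<F> n)) \<and>
     (\<forall>n. finite (sets (\<F> n))) \<and>
     sets (\<F> 0) = {{}, space M} \<and>
     (\<forall>n. \<forall>\<omega>\<in>atoms (\<F> n).
        card (children \<F> n \<omega>) = m \<and>
        (\<forall>\<eta>\<in>children \<F> n \<omega>. \<forall>\<eta>'\<in>children \<F> n \<omega>. measure M \<eta> = measure M \<eta>'))"

definition paths :: "(nat \<Rightarrow> 'a measure) \<Rightarrow> (nat \<Rightarrow> 'a set) set" where
  "paths \<F> = {\<gamma>. \<forall>n. \<gamma> n \<in> atoms (\<F> n) \<and> \<gamma> (Suc n) \<subseteq> \<gamma> n}"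

definition path_dist :: "nat \<Rightarrow> (nat \<Rightarrow> 'a set) \<Rightarrow> (nat \<Rightarrow> 'a set) \<Rightarrow> real" where
  "path_dist m \<gamma> \<gamma>' =
     (if \<gamma> = \<gamma>' then 0 else real m powr - real (Max {n. \<forall>j<n. \<gamma> j = \<gamma>' j}))"

lemma finite_agreement:
  fixes \<gamma> \<gamma>' :: "nat \<Rightarrow> 'a set"
  assumes "\<gamma> \<noteq> \<gamma>'"
  shows "finite {n. \<forall>j<n. \<gamma> j = \<gamma>' j}"
proof -
  obtain k where "\<gamma> k \<noteq> \<gamma>' k"
    using assms by (auto simp: fun_eq_iff)
  then have "{n. \<forall>j<n. \<gamma> j = \<gamma>' j} \<subseteq> {..k}"
    using not_le_imp_less by blast
  then show ?thesis
    using finite_subset by blast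
qed

lemma Metric_space_path_dist:
  assumes "m \<ge> 2"
  shows "Metric_space S (path_dist m :: (nat \<Rightarrow> 'a set) \<Rightarrow> _)"
proof
  fix x y z :: "nat \<Rightarrow> 'a set"
  show "0 \<le> path_dist m x y"
    by (simp add: path_dist_def)
  show "path_dist m x y = path_dist m y x"
    by (simp add: path_dist_def eq_commute)
  show "path_dist m x y = 0 \<longleftrightarrow> x = y"
    using assms by (simp add: path_dist_def)
  show "path_dist m x z \<le> path_dist m x y + path_dist m y z"
  proof (cases "x = y \<or> y = z \<or> x = z")
    case True
    then show ?thesis
      by (elim disjE) (simp_all add: path_dist_def)
  next
    case False
    define d where "d = (\<lambda>u v :: nat \<Rightarrow> 'a set. Max {n. \<forall>j<n. u j = v j})"
    have d_in: "\<forall>j<d u v. u j = v j" if "u \<noteq> v" for u v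
      using Max_in[OF finite_agreement[OF that]] unfolding d_def by auto
    have "\<forall>j<min (d x y) (d y z). x j = z j"
      using d_in[of x y] d_in[of y z] False by simp
    then have "min (d x y) (d y z) \<le> d x z"
      unfolding d_def using False by (intro Max_ge finite_agreement) auto
    then have "real m powr - real (d x z) \<le> real m powr - real (min (d x y) (d y z))"
      using assms by (intro powr_mono) auto
    also have "\<dots> \<le> real m powr - real (d x y) + real m powr - real (d y z)"
      by (simp add: min_def)
    finally show ?thesis
      using False by (simp add: path_dist_def d_def)
  qed
qed

definition path_borel :: "nat \<Rightarrow> (nat \<Rightarrow> 'a measure) \<Rightarrow> (nat \<Rightarrow> 'a set) measure" where
  "path_borel m \<F> =
     sigma (paths \<F>) {U. openin (Metric_space.mtopology (paths \<F>) (path_dist m)) U}"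

definition cylinder :: "(nat \<Rightarrow> 'a measure) \<Rightarrow> nat \<Rightarrow> 'a set \<Rightarrow> (nat \<Rightarrow> 'a set) set" where
  "cylinder \<F> n \<omega> = {\<gamma> \<in> paths \<F>. \<gamma> n = \<omega>}"

text \<open>
  A function that is measurable with respect to the \<open>n\<close>-th algebra is constant on the atoms of
  that algebra; the corresponding function on paths takes this constant value.
\<close>

definition on_paths :: "nat \<Rightarrow> ('a \<Rightarrow> 'b) \<Rightarrow> (nat \<Rightarrow> 'a set) \<Rightarrow> 'b" where
  "on_paths n h \<gamma> = the_elem (h ` \<gamma> n)"

section \<open>Spaces of martingales\<close>

definition zero_sum :: "('b::real_vector ^ 'm::finite) set" where
  "zero_sum = {b. (\<Sum>j\<in>UNIV. b $ j) = 0}"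

definition tensor :: "real ^ 'm \<Rightarrow> real ^ 'l \<Rightarrow> real ^ 'l ^ 'm" where
  "tensor v a = (\<chi> j. (v $ j) *\<^sub>R a)"

definition second_structural_condition :: "(real ^ 'l ^ 'm::finite) set \<Rightarrow> bool" where
  "second_structural_condition W \<longleftrightarrow>
     (\<nexists>v a. v \<in> zero_sum \<and>
        (\<exists>S c. card S = CARD('m) - 1 \<and> (\<forall>j\<in>S. v $ j = c)) \<and>
        tensor v a \<in> W \<and> tensor v a \<noteq> 0)"

text \<open>
  The library's conditional expectation is real-valued, so it is taken coordinatewise.
\<close>

definition martingale ::
  "'a measure \<Rightarrow> (nat \<Rightarrow> 'a measure) \<Rightarrow> (nat \<Rightarrow> 'a \<Rightarrow> real ^ 'l::finite) \<Rightarrow> bool" where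
  "martingale M \<F> F \<longleftrightarrow>
     (\<forall>n. F n \<in> borel_measurable (\<F> n) \<and> integrable M (F n)) \<and>
     (\<forall>n i. AE x in M. real_cond_exp M (\<F> n) (\<lambda>y. F (Suc n) y $ i) x = F n x $ i)"

definition martingale_norm :: "'a measure \<Rightarrow> (nat \<Rightarrow> 'a \<Rightarrow> real ^ 'l::finite) \<Rightarrow> real" where
  "martingale_norm M F = (SUP n. \<integral>x. norm (F n x) \<partial>M)"

definition martingale_space ::
  "'a measure \<Rightarrow> (nat \<Rightarrow> 'a measure) \<Rightarrow> ('a set \<Rightarrow> 'm::finite \<Rightarrow> 'a set) \<Rightarrow>
     (real ^ 'l::finite ^ 'm) set \<Rightarrow> (nat \<Rightarrow> 'a \<Rightarrow> real ^ 'l) set" where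
  "martingale_space M \<F> J W =
     {F. martingale M \<F> F \<and>
         bdd_above (range (\<lambda>n. \<integral>x. norm (F n x) \<partial>M)) \<and>
         (\<forall>n. \<forall>\<omega>\<in>atoms (\<F> n). \<exists>b\<in>W. \<forall>j. \<forall>x\<in>J \<omega> j. F (Suc n) x - F n x = b $ j)}"

section \<open>Riesz potentials and Lebesgue spaces\<close>

definition Lp_space :: "real \<Rightarrow> 'c measure \<Rightarrow> ('c \<Rightarrow> 'b::{banach, second_countable_topology}) set" where
  "Lp_space p \<nu> = {g \<in> borel_measurable \<nu>. integrable \<nu> (\<lambda>x. norm (g x) powr p)}"

definition Lp_norm :: "real \<Rightarrow> 'c measure \<Rightarrow> ('c \<Rightarrow> 'b::{banach, second_countable_topology}) \<Rightarrow> real" where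
  "Lp_norm p \<nu> g = (\<integral>x. norm (g x) powr p \<partial>\<nu>) powr (1 / p)"

definition Lp_converges ::
  "real \<Rightarrow> 'c measure \<Rightarrow> (nat \<Rightarrow> 'c \<Rightarrow> 'b::{banach, second_countable_topology}) \<Rightarrow> ('c \<Rightarrow> 'b) \<Rightarrow> bool" where
  "Lp_converges p \<nu> s g \<longleftrightarrow>
     (\<forall>n. s n \<in> Lp_space p \<nu>) \<and> g \<in> Lp_space p \<nu> \<and>
     (\<lambda>n. Lp_norm p \<nu> (\<lambda>x. s n x - g x)) \<longlonglongrightarrow> 0"

definition riesz_partial_sum ::
  "nat \<Rightarrow> real \<Rightarrow> (nat \<Rightarrow> 'a \<Rightarrow> 'b::real_vector) \<Rightarrow> nat \<Rightarrow> (nat \<Rightarrow> 'a set) \<Rightarrow> 'b" where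
  "riesz_partial_sum m \<alpha> F N \<gamma> =
     (\<Sum>n=1..N. (real m powr - (\<alpha> * real n)) *\<^sub>R (on_paths n (F n) \<gamma> - on_paths (n - 1) (F (n - 1)) \<gamma>))"

text \<open>
  Elements of the Lebesgue space are represented by functions, so the sum of the series is unique
  only up to almost everywhere equality; the bound is required for all its representatives.
\<close>

definition riesz_potential_continuous ::
  "nat \<Rightarrow> 'a measure \<Rightarrow> (nat \<Rightarrow> 'a \<Rightarrow> real ^ 'l::finite) set \<Rightarrow> real \<Rightarrow> real \<Rightarrow> (nat \<Rightarrow> 'a set) measure \<Rightarrow> bool" where
  "riesz_potential_continuous m M \<W> \<alpha> p \<nu> \<longleftrightarrow>
     (\<forall>F\<in>\<W>. \<exists>g. Lp_converges p \<nu> (riesz_partial_sum m \<alpha> F) g) \<and>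
     (\<exists>C. \<forall>F\<in>\<W>. \<forall>g. Lp_converges p \<nu> (riesz_partial_sum m \<alpha> F) g \<longrightarrow>
        Lp_norm p \<nu> g \<le> C * martingale_norm M F)"

definition frostman_condition ::
  "nat \<Rightarrow> (nat \<Rightarrow> 'a measure) \<Rightarrow> real \<Rightarrow> real \<Rightarrow> (nat \<Rightarrow> 'a set) measure \<Rightarrow> bool" where
  "frostman_condition m \<F> \<alpha> p \<nu> \<longleftrightarrow>
     (\<exists>C. \<forall>n. \<forall>\<omega>\<in>atoms (\<F> n).
        measure \<nu> (cylinder \<F> n \<omega>) powr (1 / p) \<le> C * real m powr ((\<alpha> - 1) * real n))"

end

theory Submission
  imports Defs
begin

text \<open>
  A martingale \<open>F\<close> is a vector-valued measure on the tree: put \<open>\<mu>(\<omega>) = m\<^sup>-\<^sup>n F\<^sub>n(\<omega>)\<close> for an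
  atom \<open>\<omega>\<close> of level \<open>n\<close>, so that \<open>\<mu>\<close> of an atom is the sum of \<open>\<mu>\<close> over its children. The total
  \<open>e\<^sub>n\<close> of \<open>\<parallel>\<mu>(\<omega>)\<parallel>\<close> over the level is \<open>E\<parallel>F\<^sub>n\<parallel>\<close>; it is nondecreasing in \<open>n\<close> and bounded by the norm
  of \<open>F\<close>.

  The second structural condition says that all of \<open>\<mu>(\<omega>)\<close> can never pass to a single child: if
  \<open>F\<^sub>n(\<omega>) + b\<^sub>j\<close> vanishes for all \<open>j\<close> but one, then \<open>b = v \<otimes> a\<close> where \<open>v\<close> has \<open>m - 1\<close> equal
  coordinates. By compactness there is then a \<open>\<theta> < 1\<close>, depending on \<open>W\<close> alone, such that no child
  carries more than the share \<open>\<theta>\<close> of the mass of all children (\<open>second_structural_max_bound\<close>).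
  For \<open>p > 1\<close> a spread-out family has a smaller \<open>\<ell>\<^sub>p\<close> norm than its \<open>\<ell>\<^sub>1\<close> norm, so the
  \<open>\<ell>\<^sub>p\<close> norm \<open>s\<^sub>n\<close> of \<open>\<omega> \<mapsto> \<parallel>\<mu>(\<omega>)\<parallel>\<close> over level \<open>n\<close> satisfies
  \<open>s\<^sub>n\<^sub>+\<^sub>1 \<le> \<kappa> (s\<^sub>n + (e\<^sub>n\<^sub>+\<^sub>1 - e\<^sub>n))\<close> with \<open>\<kappa> = \<theta>\<^bsup>(p-1)/p\<^esup> < 1\<close> (\<open>energy_step\<close>). The
  increments of \<open>e\<close> telescope, and therefore \<open>\<Sum> s\<^sub>n\<close> is at most a constant times the norm of \<open>F\<close>
  (\<open>sum_energy_le\<close>).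

  The Frostman condition is exactly what makes the norm of \<open>m\<^bsup>-\<alpha>n\<^esup> F\<^sub>n\<close> in \<open>L\<^sub>p(\<nu>)\<close> at most
  \<open>C s\<^sub>n\<close> (\<open>trace_level\<close>). Since
  \<open>m\<^bsup>-\<alpha>(n+1)\<^esup> f\<^sub>n\<^sub>+\<^sub>1 = m\<^bsup>-\<alpha>(n+1)\<^esup> F\<^sub>n\<^sub>+\<^sub>1 - m\<^sup>-\<^sup>\<alpha> (m\<^bsup>-\<alpha>n\<^esup> F\<^sub>n)\<close>,
  the series for \<open>I\<^sub>\<alpha>[F]\<close> converges absolutely in \<open>L\<^sub>p(\<nu>)\<close>, with the required bound
  (\<open>riesz_trace\<close>).
\<close>

section \<open>Minkowski's inequality and completeness of Lebesgue spaces\<close>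

text \<open>
  Convexity of \<open>t \<mapsto> t\<^sup>p\<close>, with weights chosen so that integrating the inequality for functions
  whose norms are at most \<open>a\<close> and \<open>b\<close> gives Minkowski's inequality.
\<close>

lemma powr_add_div_convex:
  fixes a b p x y :: real
  assumes "1 \<le> p" "0 < a" "0 < b" "0 \<le> x" "0 \<le> y"
  shows "((x + y) / (a + b)) powr p
    \<le> a / (a + b) * (x / a) powr p + b / (a + b) * (y / b) powr p"
proof (cases "x = 0 \<or> y = 0")
  case False
  have "((1 - b / (a + b)) *\<^sub>R (x / a) + (b / (a + b)) *\<^sub>R (y / b)) powr p
      \<le> (1 - b / (a + b)) * (x / a) powr p + b / (a + b) * (y / b) powr p"
    using assms False by (intro convex_onD[OF powr_convex]) auto
  moreover have "1 - b / (a + b) = a / (a + b)"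
    using assms by (simp add: field_simps)
  moreover have "a / (a + b) * (x / a) + b / (a + b) * (y / b) = (x + y) / (a + b)"
    using assms by (simp add: add_divide_distrib)
  ultimately show ?thesis
    by simp
next
  case True
  \<comment> \<open>If a summand vanishes, the claim reduces to \<open>t\<^sup>p \<le> t\<close> for its weight \<open>t \<le> 1\<close>.\<close>
  have scale: "(t * z) powr p \<le> t * z powr p" if "0 \<le> t" "t \<le> 1" for t z :: real
  proof -
    have "t powr p \<le> t powr 1"
      using that assms(1) by (intro powr_mono') auto
    then show ?thesis
      using that by (auto simp: powr_mult intro: mult_right_mono)
  qed
  show ?thesis
    using True scale[of "a / (a + b)" "x / a"] scale[of "b / (a + b)" "y / b"] assms
    by auto
qed

lemma Lp_norm_nonneg: "0 \<le> Lp_norm p \<nu> f"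
  by (simp add: Lp_norm_def)

lemma Lp_norm_powr: "0 < p \<Longrightarrow> Lp_norm p \<nu> f powr p = (\<integral>x. norm (f x) powr p \<partial>\<nu>)"
  by (simp add: Lp_norm_def powr_powr)

lemma Lp_norm_leI:
  assumes "0 < p" "0 \<le> a" "(\<integral>x. norm (f x) powr p \<partial>\<nu>) \<le> a powr p"
  shows "Lp_norm p \<nu> f \<le> a"
proof -
  have "Lp_norm p \<nu> f \<le> (a powr p) powr (1 / p)"
    unfolding Lp_norm_def using assms by (intro powr_mono2) auto
  then show ?thesis
    using assms by (simp add: powr_powr)
qed

lemma Lp_space_scaleR:
  assumes "f \<in> Lp_space p \<nu>"
  shows "(\<lambda>x. c *\<^sub>R f x) \<in> Lp_space p \<nu>"
  using assms by (auto simp: Lp_space_def powr_mult)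

lemma Lp_norm_scaleR:
  assumes "0 < p"
  shows "Lp_norm p \<nu> (\<lambda>x. c *\<^sub>R f x) = \<bar>c\<bar> * Lp_norm p \<nu> f"
  using assms by (simp add: Lp_norm_def powr_mult powr_powr)

text \<open>
  Minkowski's inequality with strict upper bounds for the two norms. These are positive, so that
  one may divide by them even when a norm vanishes.
\<close>

lemma Lp_minkowski_aux:
  fixes f g :: "'c \<Rightarrow> 'b::{banach, second_countable_topology}"
  assumes p: "1 \<le> p" and f: "f \<in> Lp_space p \<nu>" and g: "g \<in> Lp_space p \<nu>"
    and a: "Lp_norm p \<nu> f < a" and b: "Lp_norm p \<nu> g < b"
  shows "(\<lambda>x. f x + g x) \<in> Lp_space p \<nu> \<and> Lp_norm p \<nu> (\<lambda>x. f x + g x) \<le> a + b"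
proof -
  have a0: "0 < a" and b0: "0 < b"
    using a b Lp_norm_nonneg[of p \<nu> f] Lp_norm_nonneg[of p \<nu> g] by auto
  have [measurable]: "f \<in> borel_measurable \<nu>" "g \<in> borel_measurable \<nu>"
    and int: "integrable \<nu> (\<lambda>x. norm (f x) powr p)" "integrable \<nu> (\<lambda>x. norm (g x) powr p)"
    using f g by (auto simp: Lp_space_def)
  have norm1: "(\<integral>x. (norm (h x) / c) powr p \<partial>\<nu>) \<le> 1"
    if "Lp_norm p \<nu> h < c" "0 < c" for h :: "'c \<Rightarrow> 'b" and c
  proof -
    have "(\<integral>x. norm (h x) powr p \<partial>\<nu>) \<le> c powr p"
      using that p Lp_norm_nonneg[of p \<nu> h]
      by (subst Lp_norm_powr[symmetric]) (auto intro!: powr_mono2)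
    then show ?thesis
      using that by (simp add: powr_divide)
  qed
  define R where "R = (\<lambda>x. a / (a + b) * (norm (f x) / a) powr p + b / (a + b) * (norm (g x) / b) powr p)"
  have R_int: "integrable \<nu> R"
    unfolding R_def using int a0 b0 by (simp add: powr_divide)
  have le: "(norm (f x + g x) / (a + b)) powr p \<le> R x" for x
  proof -
    have "(norm (f x + g x) / (a + b)) powr p \<le> ((norm (f x) + norm (g x)) / (a + b)) powr p"
      using a0 b0 p by (intro powr_mono2 divide_right_mono norm_triangle_ineq) auto
    then show ?thesis
      using powr_add_div_convex[OF p a0 b0, of "norm (f x)" "norm (g x)"] by (simp add: R_def)
  qed
  have int_quot: "integrable \<nu> (\<lambda>x. (norm (f x + g x) / (a + b)) powr p)"
    using le by (intro Bochner_Integration.integrable_bound[OF R_int]) (auto intro: order_trans[OF _ abs_ge_self])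
  then have int_sum: "integrable \<nu> (\<lambda>x. norm (f x + g x) powr p)"
    using integrable_mult_right[OF int_quot, of "(a + b) powr p"] a0 b0
    by (simp add: powr_divide)
  have "(\<integral>x. (norm (f x + g x) / (a + b)) powr p \<partial>\<nu>) \<le> (\<integral>x. R x \<partial>\<nu>)"
    using le by (intro integral_mono int_quot R_int)
  also have "\<dots> = a / (a + b) * (\<integral>x. (norm (f x) / a) powr p \<partial>\<nu>) + b / (a + b) * (\<integral>x. (norm (g x) / b) powr p \<partial>\<nu>)"
    unfolding R_def using int a0 b0 by (subst Bochner_Integration.integral_add) (auto simp: powr_divide)
  also have "\<dots> \<le> a / (a + b) * 1 + b / (a + b) * 1"
    using norm1[OF a a0] norm1[OF b b0] a0 b0 by (intro add_mono mult_left_mono) auto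
  also have "\<dots> = 1"
    using a0 b0 by (simp add: add_divide_distrib[symmetric])
  finally have "(\<integral>x. norm (f x + g x) powr p \<partial>\<nu>) \<le> (a + b) powr p"
    using a0 b0 by (simp add: powr_divide)
  then show ?thesis
    using int_sum p a0 b0 by (auto simp: Lp_space_def intro!: Lp_norm_leI)
qed

lemma Lp_minkowski:
  fixes f g :: "'c \<Rightarrow> 'b::{banach, second_countable_topology}"
  assumes p: "1 \<le> p" and f: "f \<in> Lp_space p \<nu>" and g: "g \<in> Lp_space p \<nu>"
  shows "(\<lambda>x. f x + g x) \<in> Lp_space p \<nu>"
    and "Lp_norm p \<nu> (\<lambda>x. f x + g x) \<le> Lp_norm p \<nu> f + Lp_norm p \<nu> g"
proof -
  note aux = Lp_minkowski_aux[OF p f g]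
  show "(\<lambda>x. f x + g x) \<in> Lp_space p \<nu>"
    using aux[of "Lp_norm p \<nu> f + 1" "Lp_norm p \<nu> g + 1"] by simp
  show "Lp_norm p \<nu> (\<lambda>x. f x + g x) \<le> Lp_norm p \<nu> f + Lp_norm p \<nu> g"
  proof (rule field_le_epsilon)
    fix e :: real assume "0 < e"
    then show "Lp_norm p \<nu> (\<lambda>x. f x + g x) \<le> Lp_norm p \<nu> f + Lp_norm p \<nu> g + e"
      using aux[of "Lp_norm p \<nu> f + e / 2" "Lp_norm p \<nu> g + e / 2"] by simp
  qed
qed

lemma Lp_minkowski_sum:
  fixes u :: "'i \<Rightarrow> 'c \<Rightarrow> 'b::{banach, second_countable_topology}"
  assumes p: "1 \<le> p" and "finite I" and "\<And>i. i \<in> I \<Longrightarrow> u i \<in> Lp_space p \<nu>"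
  shows "(\<lambda>x. \<Sum>i\<in>I. u i x) \<in> Lp_space p \<nu>
    \<and> Lp_norm p \<nu> (\<lambda>x. \<Sum>i\<in>I. u i x) \<le> (\<Sum>i\<in>I. Lp_norm p \<nu> (u i))"
  using assms(2,3)
proof (induction I rule: finite_induct)
  case empty
  show ?case
    using p by (auto simp: Lp_space_def Lp_norm_def)
next
  case (insert i I)
  then have "u i \<in> Lp_space p \<nu>" and "(\<lambda>x. \<Sum>i\<in>I. u i x) \<in> Lp_space p \<nu>"
    and "Lp_norm p \<nu> (\<lambda>x. \<Sum>i\<in>I. u i x) \<le> (\<Sum>i\<in>I. Lp_norm p \<nu> (u i))"
    by auto
  then show ?case
    using Lp_minkowski[OF p, of "u i" \<nu> "\<lambda>x. \<Sum>i\<in>I. u i x"] insert.hyps by simp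
qed

lemma Lp_diff:
  fixes f g :: "'c \<Rightarrow> 'b::{banach, second_countable_topology}"
  assumes p: "1 \<le> p" and f: "f \<in> Lp_space p \<nu>" and g: "g \<in> Lp_space p \<nu>"
  shows "(\<lambda>x. f x - g x) \<in> Lp_space p \<nu>"
    and "Lp_norm p \<nu> (\<lambda>x. f x - g x) \<le> Lp_norm p \<nu> f + Lp_norm p \<nu> g"
  using Lp_minkowski[OF p f Lp_space_scaleR[OF g, of "-1"]] Lp_norm_scaleR[of p \<nu> "-1" g] p
  by simp_all

lemma nn_integral_Lp:
  assumes "0 < p" "f \<in> Lp_space p \<nu>"
  shows "(\<integral>\<^sup>+x. ennreal (norm (f x) powr p) \<partial>\<nu>) = ennreal (Lp_norm p \<nu> f powr p)"
  using assms by (subst nn_integral_eq_integral) (auto simp: Lp_space_def Lp_norm_powr)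

text \<open>
  Fatou's lemma: closed balls of \<open>L\<^sub>p\<close> are closed under almost everywhere convergence.
\<close>

lemma Lp_fatou:
  fixes f :: "nat \<Rightarrow> 'c \<Rightarrow> 'b::{banach, second_countable_topology}"
  assumes p: "0 < p" and f: "\<And>k. f k \<in> Lp_space p \<nu>"
    and h[measurable]: "h \<in> borel_measurable \<nu>"
    and lim: "AE x in \<nu>. (\<lambda>k. f k x) \<longlonglongrightarrow> h x"
    and bound: "\<forall>\<^sub>F k in sequentially. Lp_norm p \<nu> (f k) \<le> B" and "0 \<le> B"
  shows "h \<in> Lp_space p \<nu>" and "Lp_norm p \<nu> h \<le> B"
proof -
  have [measurable]: "f k \<in> borel_measurable \<nu>" for k
    using f[of k] by (simp add: Lp_space_def)
  have "(\<integral>\<^sup>+x. ennreal (norm (h x) powr p) \<partial>\<nu>)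
      = (\<integral>\<^sup>+x. liminf (\<lambda>k. ennreal (norm (f k x) powr p)) \<partial>\<nu>)"
  proof (rule nn_integral_cong_AE)
    from lim show "AE x in \<nu>. ennreal (norm (h x) powr p) = liminf (\<lambda>k. ennreal (norm (f k x) powr p))"
    proof eventually_elim
      case (elim x)
      then have "(\<lambda>k. ennreal (norm (f k x) powr p)) \<longlonglongrightarrow> ennreal (norm (h x) powr p)"
        using p by (intro tendsto_ennrealI tendsto_powr2 tendsto_norm) auto
      then show ?case
        by (intro lim_imp_Liminf[symmetric]) auto
    qed
  qed
  also have "\<dots> \<le> liminf (\<lambda>k. \<integral>\<^sup>+x. ennreal (norm (f k x) powr p) \<partial>\<nu>)"
    by (intro nn_integral_liminf) auto
  also have "\<dots> = liminf (\<lambda>k. ennreal (Lp_norm p \<nu> (f k) powr p))"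
    using nn_integral_Lp[OF p f] by simp
  also have "\<dots> \<le> ennreal (B powr p)"
  proof (intro Liminf_le)
    show "\<forall>\<^sub>F k in sequentially. ennreal (Lp_norm p \<nu> (f k) powr p) \<le> ennreal (B powr p)"
      using bound by eventually_elim (use p in \<open>auto intro!: powr_mono2 simp: Lp_norm_nonneg\<close>)
  qed simp
  finally have le: "(\<integral>\<^sup>+x. ennreal (norm (h x) powr p) \<partial>\<nu>) \<le> ennreal (B powr p)" .
  then have int: "integrable \<nu> (\<lambda>x. norm (h x) powr p)"
    by (intro integrableI_bounded) (auto simp: le_less_trans[OF _ ennreal_less_top])
  then show "h \<in> Lp_space p \<nu>"
    by (simp add: Lp_space_def)
  have "(\<integral>x. norm (h x) powr p \<partial>\<nu>) \<le> B powr p"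
    using le int by (subst (asm) nn_integral_eq_integral) auto
  then show "Lp_norm p \<nu> h \<le> B"
    using p \<open>0 \<le> B\<close> by (intro Lp_norm_leI)
qed

text \<open>
  The partial sums of \<open>\<Sum> \<parallel>u\<^sub>n(x)\<parallel>\<close> increase and have bounded \<open>L\<^sub>p\<close> norms, so by monotone
  convergence their limit has finite \<open>p\<close>-th moment and is finite almost everywhere.
\<close>

lemma AE_summable_norm_Lp:
  fixes u :: "nat \<Rightarrow> 'c \<Rightarrow> 'b::{banach, second_countable_topology}"
  assumes p: "1 \<le> p" and u: "\<And>n. u n \<in> Lp_space p \<nu>" and sm: "summable (\<lambda>n. Lp_norm p \<nu> (u n))"
  shows "AE x in \<nu>. summable (\<lambda>n. norm (u n x))"
proof -
  define B where "B = (\<Sum>n. Lp_norm p \<nu> (u n))"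
  define U where "U = (\<lambda>N x. \<Sum>n<N. norm (u n x))"
  have [measurable]: "u n \<in> borel_measurable \<nu>" for n
    using u[of n] by (simp add: Lp_space_def)
  have norm_u: "(\<lambda>x. norm (u n x)) \<in> Lp_space p \<nu>" for n
    using u[of n] by (simp add: Lp_space_def)
  have U_Lp: "U N \<in> Lp_space p \<nu>" and U_norm: "Lp_norm p \<nu> (U N) \<le> B" for N
  proof -
    have *: "U N \<in> Lp_space p \<nu> \<and> Lp_norm p \<nu> (U N) \<le> (\<Sum>n<N. Lp_norm p \<nu> (\<lambda>x. norm (u n x)))"
      unfolding U_def using Lp_minkowski_sum[OF p, of "{..<N}" "\<lambda>n x. norm (u n x)" \<nu>] norm_u by auto
    have "(\<Sum>n<N. Lp_norm p \<nu> (\<lambda>x. norm (u n x))) = (\<Sum>n<N. Lp_norm p \<nu> (u n))"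
      by (simp add: Lp_norm_def)
    also have "\<dots> \<le> B"
      unfolding B_def by (intro sum_le_suminf sm) (auto simp: Lp_norm_nonneg)
    finally show "U N \<in> Lp_space p \<nu>" "Lp_norm p \<nu> (U N) \<le> B"
      using * by auto
  qed
  have [measurable]: "U N \<in> borel_measurable \<nu>" for N
    using U_Lp[of N] by (simp add: Lp_space_def)
  have U0: "0 \<le> U N x" for N x
    by (simp add: U_def sum_nonneg)
  have Umono: "U N x \<le> U (Suc N) x" for N x
    by (simp add: U_def)
  have "(\<integral>\<^sup>+x. (SUP N. ennreal (norm (U N x) powr p)) \<partial>\<nu>)
      = (SUP N. \<integral>\<^sup>+x. ennreal (norm (U N x) powr p) \<partial>\<nu>)"
    using p U0 Umono
    by (intro nn_integral_monotone_convergence_SUP incseq_SucI le_funI ennreal_leI powr_mono2) auto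
  also have "\<dots> \<le> ennreal (B powr p)"
  proof (rule SUP_least)
    fix N
    have "0 < p" using p by simp
    then show "(\<integral>\<^sup>+x. ennreal (norm (U N x) powr p) \<partial>\<nu>) \<le> ennreal (B powr p)"
      using nn_integral_Lp[OF _ U_Lp[of N]] U_norm[of N]
      by (auto intro!: ennreal_leI powr_mono2 Lp_norm_nonneg)
  qed
  also have "\<dots> < \<infinity>"
    by simp
  finally have "AE x in \<nu>. (SUP N. ennreal (norm (U N x) powr p)) \<noteq> \<infinity>"
    by (intro nn_integral_PInf_AE) auto
  then show ?thesis
  proof eventually_elim
    case (elim x)
    then obtain c where c: "0 \<le> c" "(SUP N. ennreal (norm (U N x) powr p)) = ennreal c"
      by (cases "SUP N. ennreal (norm (U N x) powr p)") auto
    have "U N x \<le> c powr (1 / p)" for N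
    proof -
      have "ennreal (norm (U N x) powr p) \<le> ennreal c"
        unfolding c(2)[symmetric] by (rule SUP_upper) simp
      then have "U N x powr p \<le> c"
        using U0[of N x] c(1) by simp
      then have "(U N x powr p) powr (1 / p) \<le> c powr (1 / p)"
        using p by (intro powr_mono2) auto
      then show ?thesis
        using p U0[of N x] by (simp add: powr_powr)
    qed
    then show ?case
      by (intro summableI_nonneg_bounded[where x = "c powr (1 / p)"]) (auto simp: U_def)
  qed
qed

text \<open>
  Completeness of \<open>L\<^sub>p\<close>, for absolutely convergent series. The sum is the pointwise sum, and the
  distance to it is bounded by the tail of the series of norms, by Fatou's lemma.
\<close>

lemma Lp_converges_series:
  fixes u :: "nat \<Rightarrow> 'c \<Rightarrow> 'b::{banach, second_countable_topology}"
  assumes p: "1 \<le> p" and u: "\<And>n. u n \<in> Lp_space p \<nu>" and sm: "summable (\<lambda>n. Lp_norm p \<nu> (u n))"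
  shows "\<exists>g. Lp_converges p \<nu> (\<lambda>N x. \<Sum>n<N. u n x) g"
proof -
  define g where "g = (\<lambda>x. \<Sum>n. u n x)"
  define S where "S = (\<lambda>N x. \<Sum>n<N. u n x)"
  define tail where "tail = (\<lambda>N. \<Sum>n. Lp_norm p \<nu> (u (n + N)))"
  have p0: "0 < p" using p by simp
  have [measurable]: "u n \<in> borel_measurable \<nu>" for n
    using u[of n] by (simp add: Lp_space_def)
  have g_meas[measurable]: "g \<in> borel_measurable \<nu>"
    unfolding g_def by measurable
  have S_Lp: "S N \<in> Lp_space p \<nu>" for N
    unfolding S_def using Lp_minkowski_sum[OF p, of "{..<N}" u \<nu>] u by auto
  then have [measurable]: "S N \<in> borel_measurable \<nu>" for N
    by (simp add: Lp_space_def)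
  have lim: "AE x in \<nu>. (\<lambda>K. S K x) \<longlonglongrightarrow> g x"
    using AE_summable_norm_Lp[OF p u sm]
    by eventually_elim (auto simp: S_def g_def intro!: summable_LIMSEQ summable_norm_cancel)
  have tail0: "0 \<le> tail N" for N
    unfolding tail_def using sm by (intro suminf_nonneg) (auto simp: Lp_norm_nonneg summable_iff_shift[where f = "\<lambda>n. Lp_norm p \<nu> (u n)"])
  have part: "Lp_norm p \<nu> (\<lambda>x. S K x - S N x) \<le> tail N" if "N \<le> K" for K N
  proof -
    have eq: "S K x - S N x = (\<Sum>n<K - N. u (n + N) x)" for x
    proof -
      have "S K x = S N x + (\<Sum>n=N..<K. u n x)"
        unfolding S_def using that by (metis add.commute atLeast0LessThan le0 sum.atLeastLessThan_concat)
      then show ?thesis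
        using that sum.shift_bounds_nat_ivl[of "\<lambda>n. u n x" 0 N "K - N"] by (simp add: atLeast0LessThan)
    qed
    have "Lp_norm p \<nu> (\<lambda>x. S K x - S N x) \<le> (\<Sum>n<K - N. Lp_norm p \<nu> (u (n + N)))"
      unfolding eq using Lp_minkowski_sum[OF p, of "{..<K - N}" "\<lambda>n. u (n + N)" \<nu>] u by auto
    also have "\<dots> \<le> tail N"
      unfolding tail_def using sm by (intro sum_le_suminf) (auto simp: Lp_norm_nonneg summable_iff_shift[where f = "\<lambda>n. Lp_norm p \<nu> (u n)"])
    finally show ?thesis .
  qed
  \<comment> \<open>Fatou for \<open>S\<^sub>K - S\<^sub>N\<close> as \<open>K\<close> grows with \<open>N\<close> fixed.\<close>
  have diff: "(\<lambda>x. g x - S N x) \<in> Lp_space p \<nu>" "Lp_norm p \<nu> (\<lambda>x. g x - S N x) \<le> tail N" for N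
  proof -
    have AE: "AE x in \<nu>. (\<lambda>K. S K x - S N x) \<longlonglongrightarrow> g x - S N x"
      using lim by eventually_elim (auto intro!: tendsto_intros)
    have ev: "\<forall>\<^sub>F K in sequentially. Lp_norm p \<nu> (\<lambda>x. S K x - S N x) \<le> tail N"
      using eventually_ge_at_top[of N] by eventually_elim (rule part)
    show "(\<lambda>x. g x - S N x) \<in> Lp_space p \<nu>" "Lp_norm p \<nu> (\<lambda>x. g x - S N x) \<le> tail N"
      using Lp_fatou[OF p0 Lp_diff(1)[OF p S_Lp S_Lp[of N]] _ AE ev tail0] by auto
  qed
  have g_Lp: "g \<in> Lp_space p \<nu>"
    using diff(1)[of 0] by (simp add: S_def)
  have "tail \<longlonglongrightarrow> 0"
    unfolding tail_def by (rule suminf_exist_split2[OF sm])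
  then have "(\<lambda>N. Lp_norm p \<nu> (\<lambda>x. g x - S N x)) \<longlonglongrightarrow> 0"
    by (rule tendsto_sandwich[OF _ _ tendsto_const, rotated 2]) (auto simp: diff(2) Lp_norm_nonneg)
  then have "(\<lambda>N. Lp_norm p \<nu> (\<lambda>x. S N x - g x)) \<longlonglongrightarrow> 0"
    by (simp add: Lp_norm_def norm_minus_commute)
  then have "Lp_converges p \<nu> S g"
    using S_Lp g_Lp by (simp add: Lp_converges_def)
  then show ?thesis
    unfolding S_def by blast
qed

lemma Lp_norm_limit_le:
  fixes g :: "'c \<Rightarrow> 'b::{banach, second_countable_topology}"
  assumes p: "1 \<le> p" and conv: "Lp_converges p \<nu> S g" and bound: "\<And>N. Lp_norm p \<nu> (S N) \<le> B"
  shows "Lp_norm p \<nu> g \<le> B"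
proof (rule LIMSEQ_le_const)
  show "(\<lambda>N. B + Lp_norm p \<nu> (\<lambda>x. S N x - g x)) \<longlonglongrightarrow> B"
    using conv tendsto_add[OF tendsto_const, of _ 0 sequentially B] by (simp add: Lp_converges_def)
  have "Lp_norm p \<nu> g \<le> B + Lp_norm p \<nu> (\<lambda>x. S N x - g x)" for N
  proof -
    have SN: "S N \<in> Lp_space p \<nu>" and g: "g \<in> Lp_space p \<nu>"
      using conv by (auto simp: Lp_converges_def)
    show ?thesis
      using Lp_diff(2)[OF p SN Lp_diff(1)[OF p SN g]] bound[of N] by simp
  qed
  then show "\<exists>N0. \<forall>N\<ge>N0. Lp_norm p \<nu> g \<le> B + Lp_norm p \<nu> (\<lambda>x. S N x - g x)"
    by blast
qed

section \<open>Spreading of mass under the structural condition\<close>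

text \<open>
  The vectors \<open>y = (a + b\<^sub>j)\<^sub>j\<close> with \<open>b \<in> W\<close> form a subspace, on which the continuous function
  \<open>\<parallel>y\<^sub>j\<parallel>\<close> attains its maximum over the compact set \<open>\<Sum> \<parallel>y\<^sub>i\<parallel> = 1\<close>. If the maximum were \<open>1\<close>, all
  entries of the maximizer other than \<open>y\<^sub>j\<close> would vanish, so \<open>b\<^sub>i = -a\<close> for \<open>i \<noteq> j\<close> and, as the
  entries of \<open>b\<close> sum to zero, \<open>b\<^sub>j = (m - 1) a\<close>: a tensor that the condition excludes from \<open>W\<close>.
\<close>

lemma second_structural_max_bound:
  fixes W :: "(real ^ 'l::finite ^ 'm::finite) set"
  assumes W: "subspace W" "W \<subseteq> zero_sum" and ssc: "second_structural_condition W"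
    and card: "2 \<le> CARD('m)"
  shows "\<exists>\<theta>. 0 < \<theta> \<and> \<theta> < 1
    \<and> (\<forall>a. \<forall>b\<in>W. \<forall>j. norm (a + b $ j) \<le> \<theta> * (\<Sum>i\<in>UNIV. norm (a + b $ i)))"
proof -
  define Y where "Y = {y. \<exists>a. \<exists>b\<in>W. y = (\<chi> j. a + b $ j)}"
  define N where "N = (\<lambda>y :: real ^ 'l ^ 'm. \<Sum>i\<in>UNIV. norm (y $ i))"
  define K where "K = Y \<inter> {y. N y = 1}"
  have Y: "subspace Y"
    unfolding subspace_def
  proof safe
    show "0 \<in> Y"
      unfolding Y_def using subspace_0[OF W(1)] by (auto simp: vec_eq_iff intro!: exI[of _ 0] bexI[of _ 0])
  next
    fix x y assume "x \<in> Y" "y \<in> Y"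
    then obtain a b a' b' where "b \<in> W" "b' \<in> W" "x = (\<chi> j. a + b $ j)" "y = (\<chi> j. a' + b' $ j)"
      unfolding Y_def by auto
    then have "x + y = (\<chi> j. (a + a') + (b + b') $ j)" "b + b' \<in> W"
      using subspace_add[OF W(1)] by (auto simp: vec_eq_iff)
    then show "x + y \<in> Y"
      unfolding Y_def by blast
  next
    fix c x assume "x \<in> Y"
    then obtain a b where "b \<in> W" "x = (\<chi> j. a + b $ j)"
      unfolding Y_def by auto
    then have "c *\<^sub>R x = (\<chi> j. c *\<^sub>R a + (c *\<^sub>R b) $ j)" "c *\<^sub>R b \<in> W"
      using subspace_scale[OF W(1)] by (auto simp: vec_eq_iff algebra_simps)
    then show "c *\<^sub>R x \<in> Y"
      unfolding Y_def by blast
  qed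
  have N_cont: "continuous_on A N" for A
    unfolding N_def by (intro continuous_intros)
  have N_scale: "N (c *\<^sub>R y) = \<bar>c\<bar> * N y" for c y
    by (simp add: N_def sum_distrib_left)
  have "closed K"
    unfolding K_def
    by (intro closed_Int closed_subspace Y closed_Collect_eq N_cont continuous_on_const)
  moreover have "bounded K"
  proof (rule boundedI)
    fix y assume "y \<in> K"
    then show "norm y \<le> 1"
      unfolding K_def N_def norm_vec_def
      by (auto intro: order_trans[OF L2_set_le_sum])
  qed
  ultimately have K: "compact K"
    by (simp add: compact_eq_bounded_closed)
  have "\<exists>\<theta><1. \<forall>y\<in>K. norm (y $ j) \<le> \<theta>" for j
  proof (cases "K = {}")
    case True
    then show ?thesis by (auto intro: exI[of _ 0])
  next
    case False
    have "continuous_on K (\<lambda>y. norm (y $ j))"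
      by (intro continuous_intros)
    then obtain y where y: "y \<in> K" and max: "\<And>z. z \<in> K \<Longrightarrow> norm (z $ j) \<le> norm (y $ j)"
      using continuous_attains_sup[OF K False] by blast
    have split: "N y = norm (y $ j) + (\<Sum>i\<in>UNIV - {j}. norm (y $ i))"
      unfolding N_def by (rule sum.remove) auto
    have N1: "N y = 1"
      using y by (simp add: K_def)
    have "norm (y $ j) \<noteq> 1"
    proof
      assume one: "norm (y $ j) = 1"
      then have "(\<Sum>i\<in>UNIV - {j}. norm (y $ i)) = 0"
        using split N1 by simp
      then have zero: "y $ i = 0" if "i \<noteq> j" for i
        using that by (subst (asm) sum_nonneg_eq_0_iff) auto
      obtain a b where b: "b \<in> W" and yab: "y = (\<chi> j. a + b $ j)"
        using y unfolding K_def Y_def by auto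
      define v :: "real ^ 'm" where "v = (\<chi> i. if i = j then real CARD('m) - 1 else - 1)"
      have b_off: "b $ i = - a" if "i \<noteq> j" for i
        using zero[OF that] by (simp add: yab eq_neg_iff_add_eq_0 add.commute)
      have b_sum: "(\<Sum>i\<in>UNIV. b $ i) = 0"
        using b W(2) by (auto simp: zero_sum_def)
      have "(\<Sum>i\<in>UNIV. b $ i) = b $ j + (\<Sum>i\<in>UNIV - {j}. b $ i)"
        by (rule sum.remove) auto
      also have "(\<Sum>i\<in>UNIV - {j}. b $ i) = (\<Sum>i\<in>UNIV - {j}. - a)"
        by (intro sum.cong) (auto simp: b_off)
      also have "\<dots> = - (real CARD('m) - 1) *\<^sub>R a"
        using card by (simp only: sum_constant_scaleR) (simp add: of_nat_diff card_Diff_singleton algebra_simps)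
      finally have b_on: "b $ j = (real CARD('m) - 1) *\<^sub>R a"
        using b_sum by (simp add: algebra_simps)
      have tensor: "tensor v a = b"
        by (auto simp: tensor_def v_def vec_eq_iff[where x = "_ :: real ^ 'l ^ 'm"] b_on b_off)
      have "(\<Sum>i\<in>UNIV. v $ i) = v $ j + (\<Sum>i\<in>UNIV - {j}. v $ i)"
        by (rule sum.remove) auto
      also have "(\<Sum>i\<in>UNIV - {j}. v $ i) = (\<Sum>i\<in>UNIV - {j}. - 1)"
        by (intro sum.cong) (auto simp: v_def)
      also have "v $ j + \<dots> = 0"
        using card by (simp add: v_def of_nat_diff card_Diff_singleton)
      finally have "v \<in> zero_sum"
        by (simp add: zero_sum_def)
      moreover have "\<exists>S c. card S = CARD('m) - 1 \<and> (\<forall>i\<in>S. v $ i = c)"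
        by (intro exI[of _ "UNIV - {j}"] exI[of _ "- 1"]) (auto simp: v_def card_Diff_singleton)
      moreover have "tensor v a \<noteq> 0"
      proof
        assume "tensor v a = 0"
        then have "b = 0"
          using tensor by simp
        moreover obtain i where "i \<noteq> j"
          using card by (metis UNIV_I card_1_singleton_iff card_le_Suc0_iff_eq finite le_antisym not_less_eq_eq numeral_2_eq_2)
        ultimately have "a = 0"
          using b_off by force
        with \<open>b = 0\<close> show False
          using one by (simp add: yab)
      qed
      ultimately show False
        using ssc b tensor unfolding second_structural_condition_def by blast
    qed
    moreover have "norm (y $ j) \<le> 1"
      using split N1 sum_nonneg[of "UNIV - {j}" "\<lambda>i. norm (y $ i)"] by simp
    ultimately show ?thesis
      using max by (intro exI[of _ "norm (y $ j)"]) auto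
  qed
  then obtain t where t: "\<And>j. t j < 1" "\<And>j y. y \<in> K \<Longrightarrow> norm (y $ j) \<le> t j"
    by metis
  \<comment> \<open>The entry \<open>1/2\<close> makes \<open>\<theta>\<close> positive, as the bounds \<open>t j\<close> need not be.\<close>
  define \<theta> where "\<theta> = Max (insert (1 / 2) (range t))"
  have "norm (a + b $ j) \<le> \<theta> * (\<Sum>i\<in>UNIV. norm (a + b $ i))" if b: "b \<in> W" for a b j
  proof -
    define y where "y = (\<chi> j. a + b $ j)"
    have y: "y \<in> Y"
      using b unfolding Y_def y_def by blast
    have N0: "0 \<le> N y"
      by (simp add: N_def sum_nonneg)
    show ?thesis
    proof (cases "N y = 0")
      case True
      then have "a + b $ j = 0"
        by (simp add: N_def y_def sum_nonneg_eq_0_iff)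
      then show ?thesis
        using True by (simp add: N_def y_def)
    next
      case False
      have "N ((1 / N y) *\<^sub>R y) = 1 / N y * N y"
        using N0 by (simp add: N_scale)
      then have "N ((1 / N y) *\<^sub>R y) = 1"
        using False by simp
      then have "(1 / N y) *\<^sub>R y \<in> K"
        using subspace_scale[OF Y y] by (simp add: K_def)
      then have "norm (((1 / N y) *\<^sub>R y) $ j) \<le> t j"
        by (rule t(2))
      also have "t j \<le> \<theta>"
        unfolding \<theta>_def by (intro Max_ge) auto
      finally have "norm (y $ j) \<le> \<theta> * N y"
        using False N0 by (simp add: field_simps)
      then show ?thesis
        by (simp add: y_def N_def)
    qed
  qed
  moreover have "\<theta> < 1"
    using t(1) by (simp add: \<theta>_def)
  moreover have "1 / 2 \<le> \<theta>"
    unfolding \<theta>_def by (intro Max_ge) auto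
  ultimately show ?thesis
    by (intro exI[of _ \<theta>]) auto
qed

text \<open>
  Write \<open>x\<^sub>i\<^sup>p = x\<^sub>i\<^bsup>p-1\<^esup> x\<^sub>i\<close> and use the bound on the entries in the first factor only. With
  \<open>\<theta> < 1\<close> this is the gain of the \<open>\<ell>\<^sub>p\<close> over the \<open>\<ell>\<^sub>1\<close> norm; with \<open>\<theta> = 1\<close> it is the embedding of
  \<open>\<ell>\<^sub>1\<close> into \<open>\<ell>\<^sub>p\<close>.
\<close>

lemma sum_powr_le_max:
  fixes x :: "'i \<Rightarrow> real"
  assumes p: "1 \<le> p" and "finite I" and x0: "\<And>i. i \<in> I \<Longrightarrow> 0 \<le> x i"
    and le: "\<And>i. i \<in> I \<Longrightarrow> x i \<le> \<theta> * sum x I" and \<theta>: "0 \<le> \<theta>"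
  shows "(\<Sum>i\<in>I. x i powr p) \<le> \<theta> powr (p - 1) * sum x I powr p"
proof -
  have s0: "0 \<le> sum x I"
    using x0 by (rule sum_nonneg)
  have split: "y powr p = y powr (p - 1) * y" if "0 \<le> y" for y :: real
    using that powr_add[of y "p - 1" 1] by (cases "y = 0") auto
  have "(\<Sum>i\<in>I. x i powr p) \<le> (\<Sum>i\<in>I. (\<theta> * sum x I) powr (p - 1) * x i)"
  proof (rule sum_mono)
    fix i assume i: "i \<in> I"
    have "x i powr (p - 1) * x i \<le> (\<theta> * sum x I) powr (p - 1) * x i"
      using x0[OF i] le[OF i] p by (intro mult_right_mono powr_mono2) auto
    then show "x i powr p \<le> (\<theta> * sum x I) powr (p - 1) * x i"
      using split[OF x0[OF i]] by simp
  qed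
  also have "\<dots> = (\<theta> * sum x I) powr (p - 1) * sum x I"
    by (simp add: sum_distrib_left)
  also have "\<dots> = \<theta> powr (p - 1) * sum x I powr p"
    using s0 \<theta> split[OF s0] by (simp add: powr_mult)
  finally show ?thesis .
qed

text \<open>
  Summing the recursion, the increments of \<open>e\<close> telescope and the sum of \<open>s\<close> on the right carries
  the factor \<open>\<kappa> < 1\<close>, so it can be absorbed on the left.
\<close>

lemma sum_le_of_contraction:
  fixes s e :: "nat \<Rightarrow> real"
  assumes \<kappa>: "0 \<le> \<kappa>" "\<kappa> < 1" and s0: "\<And>n. 0 \<le> s n" and start: "s 0 \<le> e 0"
    and step: "\<And>n. s (Suc n) \<le> \<kappa> * (s n + (e (Suc n) - e n))" and e: "\<And>n. e n \<le> B"
  shows "(\<Sum>n<N. s n) \<le> B / (1 - \<kappa>)"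
proof -
  let ?T = "\<Sum>n<Suc N. s n"
  have "?T = s 0 + (\<Sum>n<N. s (Suc n))"
    by (rule sum.lessThan_Suc_shift)
  also have "\<dots> \<le> e 0 + (\<Sum>n<N. \<kappa> * (s n + (e (Suc n) - e n)))"
    by (intro add_mono start sum_mono step)
  also have "\<dots> = e 0 + \<kappa> * ((\<Sum>n<N. s n) + (e N - e 0))"
    by (simp add: sum_distrib_left[symmetric] sum.distrib sum_lessThan_telescope)
  also have "\<dots> \<le> e 0 + \<kappa> * (?T + (e N - e 0))"
    using \<kappa> s0 by (intro add_left_mono mult_left_mono) auto
  finally have "?T * (1 - \<kappa>) \<le> (1 - \<kappa>) * e 0 + \<kappa> * e N"
    by (simp add: algebra_simps)
  also have "\<dots> \<le> (1 - \<kappa>) * B + \<kappa> * B"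
    using \<kappa> e by (intro add_mono mult_left_mono) auto
  finally have "?T \<le> B / (1 - \<kappa>)"
    using \<kappa> by (simp add: pos_le_divide_eq algebra_simps)
  then show ?thesis
    using s0[of N] by simp
qed

section \<open>Atoms of finite algebras\<close>

lemma atom_in_sets: "A \<in> atoms N \<Longrightarrow> A \<in> sets N"
  and atom_nonempty: "A \<in> atoms N \<Longrightarrow> A \<noteq> {}"
  unfolding atoms_def by blast+

lemma atomD: "A \<in> atoms N \<Longrightarrow> B \<in> sets N \<Longrightarrow> B \<subseteq> A \<Longrightarrow> B \<noteq> {} \<Longrightarrow> B = A"
  unfolding atoms_def by blast

lemma atomI:
  assumes "A \<in> sets N" "A \<noteq> {}" "\<And>B. B \<in> sets N \<Longrightarrow> B \<subseteq> A \<Longrightarrow> B = {} \<or> B = A"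
  shows "A \<in> atoms N"
  unfolding atoms_def using assms by simp

text \<open>
  A minimal element of the finite family of measurable sets containing \<open>x\<close> is an atom: a
  measurable subset of it or the complement of this subset in it belongs to the family.
\<close>

lemma atom_covering:
  assumes "finite (sets N)" "x \<in> space N"
  shows "\<exists>A\<in>atoms N. x \<in> A"
proof -
  define S where "S = {B \<in> sets N. x \<in> B}"
  have "finite S" "S \<noteq> {}"
    using assms unfolding S_def by auto
  from finite_has_minimal[OF this] obtain A where "A \<in> S" and min: "\<forall>B\<in>S. B \<subseteq> A \<longrightarrow> A = B"
    by (elim bexE)
  then have A: "A \<in> sets N" "x \<in> A"
    by (simp_all only: S_def mem_Collect_eq)
  have "A \<in> atoms N"
  proof (rule atomI)
    fix B assume B: "B \<in> sets N" "B \<subseteq> A"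
    show "B = {} \<or> B = A"
    proof (cases "x \<in> B")
      case True
      then have "B \<in> S"
        using B(1) by (simp only: S_def mem_Collect_eq simp_thms)
      from mp[OF bspec[OF min this] B(2)] show ?thesis
        by simp
    next
      case False
      then have "A - B \<in> S"
        using A sets.Diff[OF A(1) B(1)] by (simp only: S_def mem_Collect_eq Diff_iff simp_thms)
      from mp[OF bspec[OF min this] Diff_subset] have "A \<inter> B = {}"
        by (metis Diff_disjoint Int_commute)
      then have "B = {}"
        using B(2) by (simp only: Int_absorb1)
      then show ?thesis
        by (rule disjI1)
    qed
  qed (use A in blast)+
  then show ?thesis
    using A(2) by (rule bexI[rotated])
qed

lemma atoms_disjoint:
  assumes A: "A \<in> atoms N" and B: "B \<in> atoms N" and "A \<noteq> B"
  shows "A \<inter> B = {}"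
proof (rule ccontr)
  assume ne: "A \<inter> B \<noteq> {}"
  have sets: "A \<inter> B \<in> sets N"
    by (intro sets.Int atom_in_sets A B)
  have "A = A \<inter> B"
    using atomD[OF A sets Int_lower1 ne] by (rule sym)
  also have "\<dots> = B"
    by (rule atomD[OF B sets Int_lower2 ne])
  finally show False
    using \<open>A \<noteq> B\<close> by (rule notE[rotated])
qed

lemma measurable_constant_on_atom:
  fixes h :: "'a \<Rightarrow> 'b::t1_space"
  assumes h: "h \<in> borel_measurable N" and A: "A \<in> atoms N" and x: "x \<in> A" and y: "y \<in> A"
  shows "h y = h x"
proof -
  define L where "L = h -` {h x} \<inter> space N"
  have "A \<subseteq> space N"
    by (rule sets.sets_into_space[OF atom_in_sets[OF A]])
  then have ne: "A \<inter> L \<noteq> {}"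
    using x by (auto simp: L_def)
  have "L \<in> sets N"
    unfolding L_def using h by (rule measurable_sets) auto
  then have "A \<inter> L \<in> sets N"
    using atom_in_sets[OF A] by (intro sets.Int)
  then have "A \<inter> L = A"
    using ne by (rule atomD[OF A _ Int_lower1])
  then have "y \<in> L"
    using y by blast
  then show ?thesis
    by (simp add: L_def)
qed

text \<open>
  The value of a function that is constant on the atom; evaluation along a path reads it off at the
  atom through which the path passes.
\<close>

definition atom_value :: "('a \<Rightarrow> 'b) \<Rightarrow> 'a set \<Rightarrow> 'b" where
  "atom_value h \<omega> = the_elem (h ` \<omega>)"

lemma on_paths_eq_atom_value: "on_paths n h \<gamma> = atom_value h (\<gamma> n)"
  by (simp add: on_paths_def atom_value_def)

lemma atom_value_eq:
  fixes h :: "'a \<Rightarrow> 'b::t1_space"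
  assumes "h \<in> borel_measurable N" "A \<in> atoms N" "x \<in> A"
  shows "atom_value h A = h x"
proof -
  have "h ` A = (\<lambda>_. h x) ` A"
    by (rule image_cong[OF refl measurable_constant_on_atom[OF assms]])
  also have "\<dots> = {h x}"
    using assms(3) by (rule image_constant)
  finally have "h ` A = {h x}" .
  then show ?thesis
    by (simp add: atom_value_def)
qed

text \<open>
  The common form of the integrals over a level of the tree: the pieces are the atoms in the
  probability space and the cylinders in the space of paths.
\<close>

lemma integral_finite_partition:
  fixes f :: "'c \<Rightarrow> 'b::{banach, second_countable_topology}"
  assumes "finite_measure N" "finite I" and B: "\<And>i. i \<in> I \<Longrightarrow> B i \<in> sets N"
    and f: "\<And>i x. i \<in> I \<Longrightarrow> x \<in> B i \<Longrightarrow> f x = \<phi> i"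
    and disj: "\<And>i j. i \<in> I \<Longrightarrow> j \<in> I \<Longrightarrow> i \<noteq> j \<Longrightarrow> B i \<inter> B j = {}"
    and cover: "\<And>x. x \<in> space N \<Longrightarrow> \<exists>i\<in>I. x \<in> B i"
  shows "integrable N f" and "(\<integral>x. f x \<partial>N) = (\<Sum>i\<in>I. measure N (B i) *\<^sub>R \<phi> i)"
proof -
  interpret finite_measure N by fact
  have eq: "f x = (\<Sum>i\<in>I. indicator (B i) x *\<^sub>R \<phi> i)" if x: "x \<in> space N" for x
  proof -
    obtain i where i: "i \<in> I" "x \<in> B i"
      using cover[OF x] by blast
    have "(\<Sum>j\<in>I. indicator (B j) x *\<^sub>R \<phi> j) = (\<Sum>j\<in>I. if j = i then \<phi> i else 0)"
      using i disj by (intro sum.cong) (auto simp: indicator_def)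
    then show ?thesis
      using i f assms(2) by simp
  qed
  have int: "integrable N (\<lambda>x. indicator (B i) x *\<^sub>R \<phi> i)" if "i \<in> I" for i
    using B[OF that] by (intro integrable_scaleR_left integrable_real_indicator) (auto simp: emeasure_eq_measure)
  then have "integrable N (\<lambda>x. \<Sum>i\<in>I. indicator (B i) x *\<^sub>R \<phi> i)"
    by (intro Bochner_Integration.integrable_sum)
  then show "integrable N f"
    using eq Bochner_Integration.integrable_cong[of N N f "\<lambda>x. \<Sum>i\<in>I. indicator (B i) x *\<^sub>R \<phi> i"] by simp
  have "(\<integral>x. f x \<partial>N) = (\<integral>x. (\<Sum>i\<in>I. indicator (B i) x *\<^sub>R \<phi> i) \<partial>N)"
    by (intro Bochner_Integration.integral_cong eq refl)
  also have "\<dots> = (\<Sum>i\<in>I. \<integral>x. indicator (B i) x *\<^sub>R \<phi> i \<partial>N)"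
    by (intro Bochner_Integration.integral_sum int)
  also have "\<dots> = (\<Sum>i\<in>I. measure N (B i) *\<^sub>R \<phi> i)"
  proof (intro sum.cong refl)
    fix i assume i: "i \<in> I"
    then have "integrable N (indicator (B i) :: 'c \<Rightarrow> real)"
      using B by (intro integrable_real_indicator) (auto simp: emeasure_eq_measure)
    then show "(\<integral>x. indicator (B i) x *\<^sub>R \<phi> i \<partial>N) = measure N (B i) *\<^sub>R \<phi> i"
      using B[OF i] sets.Int_space_eq2[OF B[OF i]] by simp
  qed
  finally show "(\<integral>x. f x \<partial>N) = (\<Sum>i\<in>I. measure N (B i) *\<^sub>R \<phi> i)" .
qed

section \<open>The tree of atoms and its paths\<close>

locale uniform_tree =
  fixes m :: nat and M :: "'a measure" and \<F> :: "nat \<Rightarrow> 'a measure"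
  assumes uniform: "m_uniform_filtration m M \<F>" and m2: "2 \<le> m"
begin

lemmas uniformD = uniform[unfolded m_uniform_filtration_def]

lemmas prob = uniformD[THEN conjunct1]
  and filtration = uniformD[THEN conjunct2, THEN conjunct1]
  and subalg = uniformD[THEN conjunct2, THEN conjunct2, THEN conjunct1, THEN spec]
  and finite_sets = uniformD[THEN conjunct2, THEN conjunct2, THEN conjunct2, THEN conjunct1, THEN spec]
  and sets_0 = uniformD[THEN conjunct2, THEN conjunct2, THEN conjunct2, THEN conjunct2, THEN conjunct1]
  and children_spec = uniformD[THEN conjunct2, THEN conjunct2, THEN conjunct2, THEN conjunct2, THEN conjunct2,
    THEN spec, THEN bspec]

lemma space_level: "space (\<F> n) = space M" and sets_level: "sets (\<F> n) \<subseteq> sets M"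
  using subalg[of n] by (auto simp: subalgebra_def)

lemma sets_level_Suc: "sets (\<F> n) \<subseteq> sets (\<F> (Suc n))"
  using filtration.sets_F_mono[OF filtration, of n "Suc n"] by simp

lemmas card_children = children_spec[THEN conjunct1]
  and children_equal = children_spec[THEN conjunct2, THEN bspec, THEN bspec]

lemma finite_atoms: "finite (atoms (\<F> n))"
  by (rule finite_subset[OF _ finite_sets]) (rule subsetI, rule atom_in_sets)

lemma finite_children: "finite (children \<F> n \<omega>)"
  by (rule finite_subset[OF _ finite_atoms]) (auto simp: children_def)

lemma atom_sets: "\<omega> \<in> atoms (\<F> n) \<Longrightarrow> \<omega> \<in> sets M"
  using sets_level atom_in_sets by (rule subsetD)

lemma atoms_cover: "x \<in> space M \<Longrightarrow> \<exists>\<omega>\<in>atoms (\<F> n). x \<in> \<omega>"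
  using atom_covering[OF finite_sets, of x n] by (simp add: space_level)

lemma atoms_0: "atoms (\<F> 0) = {space M}"
proof -
  have ne: "space M \<noteq> {}"
    by (rule prob_space.not_empty[OF prob])
  then have "space M \<in> atoms (\<F> 0)"
    by (simp add: atoms_def sets_0)
  moreover have "\<omega> = space M" if "\<omega> \<in> atoms (\<F> 0)" for \<omega>
    using atom_in_sets[OF that] atom_nonempty[OF that] by (simp add: sets_0)
  ultimately show ?thesis
    by blast
qed

lemma childI:
  assumes \<omega>: "\<omega> \<in> atoms (\<F> n)" and \<eta>: "\<eta> \<in> atoms (\<F> (Suc n))" and x: "x \<in> \<omega>" "x \<in> \<eta>"
  shows "\<eta> \<in> children \<F> n \<omega>"
proof -
  have "\<eta> \<inter> \<omega> \<in> sets (\<F> (Suc n))"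
    using subsetD[OF sets_level_Suc atom_in_sets[OF \<omega>]] atom_in_sets[OF \<eta>] by (intro sets.Int)
  moreover have "\<eta> \<inter> \<omega> \<noteq> {}"
    using x by blast
  ultimately have "\<eta> \<inter> \<omega> = \<eta>"
    by (rule atomD[OF \<eta> _ Int_lower1])
  then have "\<eta> \<subseteq> \<omega>"
    by (simp only: inf.absorb_iff1)
  then show ?thesis
    using \<eta> by (simp add: children_def)
qed

lemma childD: "\<eta> \<in> children \<F> n \<omega> \<Longrightarrow> \<eta> \<in> atoms (\<F> (Suc n))" "\<eta> \<in> children \<F> n \<omega> \<Longrightarrow> \<eta> \<subseteq> \<omega>"
  by (simp_all add: children_def)

lemma atom_through_point:
  assumes "x \<in> \<omega>" "\<omega> \<in> atoms (\<F> n)"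
  obtains \<eta> where "\<eta> \<in> atoms (\<F> k)" "x \<in> \<eta>"
proof -
  have "x \<in> space M"
    using subsetD[OF sets.sets_into_space[OF atom_sets[OF assms(2)]] assms(1)] .
  from atoms_cover[OF this, of k] show thesis
    by (rule bexE) (rule that)
qed

lemma Union_children:
  assumes \<omega>: "\<omega> \<in> atoms (\<F> n)"
  shows "\<Union> (children \<F> n \<omega>) = \<omega>"
proof
  show "\<Union> (children \<F> n \<omega>) \<subseteq> \<omega>"
    by (rule Union_least) (rule childD(2))
  show "\<omega> \<subseteq> \<Union> (children \<F> n \<omega>)"
  proof
    fix x assume x: "x \<in> \<omega>"
    obtain \<eta> where \<eta>: "\<eta> \<in> atoms (\<F> (Suc n))" "x \<in> \<eta>"
      by (rule atom_through_point[OF x \<omega>])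
    show "x \<in> \<Union> (children \<F> n \<omega>)"
      by (rule UnionI[OF childI[OF \<omega> \<eta>(1) x \<eta>(2)] \<eta>(2)])
  qed
qed

lemma atoms_Suc: "atoms (\<F> (Suc n)) = (\<Union>\<omega>\<in>atoms (\<F> n). children \<F> n \<omega>)"
proof
  show "atoms (\<F> (Suc n)) \<subseteq> (\<Union>\<omega>\<in>atoms (\<F> n). children \<F> n \<omega>)"
  proof
    fix \<eta> assume \<eta>: "\<eta> \<in> atoms (\<F> (Suc n))"
    from ex_in_conv[THEN iffD2, OF atom_nonempty[OF \<eta>]] obtain x where x: "x \<in> \<eta>"
      by (elim exE)
    obtain \<omega> where \<omega>: "\<omega> \<in> atoms (\<F> n)" "x \<in> \<omega>"
      by (rule atom_through_point[OF x \<eta>])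
    show "\<eta> \<in> (\<Union>\<omega>\<in>atoms (\<F> n). children \<F> n \<omega>)"
      using \<omega>(1) by (rule UN_I) (rule childI[OF \<omega>(1) \<eta> \<omega>(2) x])
  qed
  show "(\<Union>\<omega>\<in>atoms (\<F> n). children \<F> n \<omega>) \<subseteq> atoms (\<F> (Suc n))"
    by (rule UN_least) (rule subsetI, rule childD(1))
qed

lemma sum_atoms_Suc:
  fixes g :: "'a set \<Rightarrow> real"
  shows "(\<Sum>\<eta>\<in>atoms (\<F> (Suc n)). g \<eta>) = (\<Sum>\<omega>\<in>atoms (\<F> n). \<Sum>\<eta>\<in>children \<F> n \<omega>. g \<eta>)"
  unfolding atoms_Suc
proof (rule sum.UNION_disjoint[OF finite_atoms], intro ballI finite_children, intro ballI impI)
  fix \<omega> \<omega>' assume "\<omega> \<in> atoms (\<F> n)" "\<omega>' \<in> atoms (\<F> n)" "\<omega> \<noteq> \<omega>'"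
  then have disjoint: "\<omega> \<inter> \<omega>' = {}"
    by (rule atoms_disjoint)
  show "children \<F> n \<omega> \<inter> children \<F> n \<omega>' = {}"
  proof (rule equals0I)
    fix \<eta> assume "\<eta> \<in> children \<F> n \<omega> \<inter> children \<F> n \<omega>'"
    then have \<eta>: "\<eta> \<in> children \<F> n \<omega>" "\<eta> \<in> children \<F> n \<omega>'"
      by (rule IntD1, rule IntD2)
    have "\<eta> \<subseteq> \<omega> \<inter> \<omega>'"
      by (rule Int_greatest[OF childD(2)[OF \<eta>(1)] childD(2)[OF \<eta>(2)]])
    then show False
      using disjoint atom_nonempty[OF childD(1)[OF \<eta>(1)]] by simp
  qed
qed

text \<open>
  The children of an atom are disjoint, cover it and have equal probabilities, and there are \<open>m\<close> of
  them; so each level divides the probability by \<open>m\<close>.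
\<close>

lemma measure_atom: "\<omega> \<in> atoms (\<F> n) \<Longrightarrow> measure M \<omega> = 1 / real m ^ n"
proof (induction n arbitrary: \<omega>)
  case 0
  then show ?case
    using prob_space.prob_space[OF prob] by (simp add: atoms_0)
next
  case (Suc n)
  interpret prob_space M by (rule prob)
  obtain \<omega>' where \<omega>': "\<omega>' \<in> atoms (\<F> n)" "\<omega> \<in> children \<F> n \<omega>'"
    using Suc.prems atoms_Suc by blast
  have "measure M \<omega>' = measure M (\<Union>\<eta>\<in>children \<F> n \<omega>'. \<eta>)"
    using Union_children[OF \<omega>'(1)] by simp
  also have "\<dots> = (\<Sum>\<eta>\<in>children \<F> n \<omega>'. measure M \<eta>)"
  proof (rule finite_measure_finite_Union[OF finite_children])
    show "(\<lambda>\<eta>. \<eta>) ` children \<F> n \<omega>' \<subseteq> sets M"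
      unfolding children_def using atom_sets[of _ "Suc n"] by blast
    show "disjoint_family_on (\<lambda>\<eta>. \<eta>) (children \<F> n \<omega>')"
    unfolding disjoint_family_on_def
    proof (intro ballI impI)
      fix \<eta> \<eta>' assume "\<eta> \<in> children \<F> n \<omega>'" "\<eta>' \<in> children \<F> n \<omega>'" "\<eta> \<noteq> \<eta>'"
      then show "\<eta> \<inter> \<eta>' = {}"
        unfolding children_def by (intro atoms_disjoint[of _ "\<F> (Suc n)"]) simp_all
    qed
  qed
  also have "\<dots> = (\<Sum>\<eta>\<in>children \<F> n \<omega>'. measure M \<omega>)"
    by (intro sum.cong refl children_equal[OF \<omega>'(1) _ \<omega>'(2)])
  also have "\<dots> = real m * measure M \<omega>"
    using card_children[OF \<omega>'(1)] by simp
  finally show ?case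
    unfolding Suc.IH[OF \<omega>'(1)] using m2 by (simp add: field_simps)
qed

lemma integral_norm_level:
  fixes h :: "'a \<Rightarrow> 'b::{banach, second_countable_topology}"
  assumes "h \<in> borel_measurable (\<F> n)"
  shows "(\<integral>x. norm (h x) \<partial>M) = (\<Sum>\<omega>\<in>atoms (\<F> n). norm (atom_value h \<omega>) / real m ^ n)"
proof -
  interpret prob_space M by (rule prob)
  have "(\<integral>x. norm (h x) \<partial>M) = (\<Sum>\<omega>\<in>atoms (\<F> n). measure M \<omega> *\<^sub>R norm (atom_value h \<omega>))"
  proof (rule integral_finite_partition(2)[where B = "\<lambda>\<omega>. \<omega>", OF finite_measure_axioms finite_atoms])
    show "\<omega> \<inter> \<omega>' = {}" if "\<omega> \<in> atoms (\<F> n)" "\<omega>' \<in> atoms (\<F> n)" "\<omega> \<noteq> \<omega>'" for \<omega> \<omega>'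
      using that by (rule atoms_disjoint)
    show "norm (h x) = norm (atom_value h \<omega>)" if "\<omega> \<in> atoms (\<F> n)" "x \<in> \<omega>" for \<omega> x
      using atom_value_eq[OF assms that] by simp
    show "\<omega> \<in> sets M" if "\<omega> \<in> atoms (\<F> n)" for \<omega>
      using that by (rule atom_sets)
    show "\<exists>\<omega>\<in>atoms (\<F> n). x \<in> \<omega>" if "x \<in> space M" for x
      using that by (rule atoms_cover)
  qed
  also have "\<dots> = (\<Sum>\<omega>\<in>atoms (\<F> n). norm (atom_value h \<omega>) / real m ^ n)"
    by (intro sum.cong refl) (simp add: measure_atom)
  finally show ?thesis .
qed

text \<open>
  Two paths at distance less than \<open>m\<^sup>-\<^sup>n\<close> agree up to and including level \<open>n\<close>, so a cylinder of
  level \<open>n\<close> contains the ball of this radius around each of its points.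
\<close>

lemma openin_cylinder:
  "openin (Metric_space.mtopology (paths \<F>) (path_dist m)) (cylinder \<F> n \<omega>)"
proof -
  interpret Metric_space "paths \<F>" "path_dist m :: (nat \<Rightarrow> 'a set) \<Rightarrow> _"
    by (rule Metric_space_path_dist[OF m2])
  have "mball \<gamma> (real m powr - real n) \<subseteq> cylinder \<F> n \<omega>" if \<gamma>: "\<gamma> \<in> cylinder \<F> n \<omega>" for \<gamma>
  proof
    fix \<gamma>' assume \<gamma>': "\<gamma>' \<in> mball \<gamma> (real m powr - real n)"
    have "\<gamma> n = \<gamma>' n"
    proof (cases "\<gamma> = \<gamma>'")
      case False
      define d where "d = Max {k. \<forall>j<k. \<gamma> j = \<gamma>' j}"
      have "d \<in> {k. \<forall>j<k. \<gamma> j = \<gamma>' j}"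
        unfolding d_def by (intro Max_in finite_agreement[OF False]) auto
      moreover have "real m powr - real d < real m powr - real n"
        using \<gamma>' False by (simp add: path_dist_def d_def)
      then have "n < d"
        using m2 by (simp add: powr_less_cancel_iff)
      ultimately show ?thesis
        by blast
    qed simp
    then show "\<gamma>' \<in> cylinder \<F> n \<omega>"
      using \<gamma> \<gamma>' by (auto simp: cylinder_def)
  qed
  moreover have "0 < real m powr - real n"
    using m2 by simp
  moreover have "cylinder \<F> n \<omega> \<subseteq> paths \<F>"
    by (auto simp: cylinder_def)
  ultimately show ?thesis
    unfolding openin_mtopology by (intro conjI allI impI exI[of _ "real m powr - real n"])
qed

lemma path_borel: "space (path_borel m \<F>) = paths \<F>" "cylinder \<F> n \<omega> \<in> sets (path_borel m \<F>)"
proof -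
  interpret Metric_space "paths \<F>" "path_dist m :: (nat \<Rightarrow> 'a set) \<Rightarrow> _"
    by (rule Metric_space_path_dist[OF m2])
  have sub: "{U. openin mtopology U} \<subseteq> Pow (paths \<F>)"
    using openin_subset topspace_mtopology by blast
  show "space (path_borel m \<F>) = paths \<F>"
    unfolding path_borel_def by (rule space_measure_of[OF sub])
  show "cylinder \<F> n \<omega> \<in> sets (path_borel m \<F>)"
    unfolding path_borel_def sets_measure_of[OF sub] using openin_cylinder by (intro sigma_sets.Basic) auto
qed

lemma integral_paths_level:
  fixes \<phi> :: "'a set \<Rightarrow> 'b::{banach, second_countable_topology}"
  assumes "finite_measure \<nu>" "sets \<nu> = sets (path_borel m \<F>)"
  shows "integrable \<nu> (\<lambda>\<gamma>. \<phi> (\<gamma> n))"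
    and "(\<integral>\<gamma>. \<phi> (\<gamma> n) \<partial>\<nu>) = (\<Sum>\<omega>\<in>atoms (\<F> n). measure \<nu> (cylinder \<F> n \<omega>) *\<^sub>R \<phi> \<omega>)"
proof -
  have "space \<nu> = paths \<F>"
    using sets_eq_imp_space_eq[OF assms(2)] path_borel(1) by simp
  then have cover: "\<exists>\<omega>\<in>atoms (\<F> n). \<gamma> \<in> cylinder \<F> n \<omega>" if "\<gamma> \<in> space \<nu>" for \<gamma>
    using that by (auto simp: cylinder_def paths_def)
  have meas: "cylinder \<F> n \<omega> \<in> sets \<nu>" for \<omega>
    unfolding assms(2) by (rule path_borel(2))
  have value_on: "\<phi> (\<gamma> n) = \<phi> \<omega>" if "\<gamma> \<in> cylinder \<F> n \<omega>" for \<gamma> \<omega>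
    using that by (simp add: cylinder_def)
  have disjoint: "cylinder \<F> n \<omega> \<inter> cylinder \<F> n \<omega>' = {}" if "\<omega> \<noteq> \<omega>'" for \<omega> \<omega>'
    using that by (auto simp: cylinder_def)
  note part = integral_finite_partition[where N = \<nu> and I = "atoms (\<F> n)" and B = "cylinder \<F> n" and f = "\<lambda>\<gamma>. \<phi> (\<gamma> n)" and \<phi> = \<phi>,
      OF assms(1) finite_atoms meas]
  show "integrable \<nu> (\<lambda>\<gamma>. \<phi> (\<gamma> n))"
    by (rule part(1)) (erule value_on, erule disjoint, erule cover)
  show "(\<integral>\<gamma>. \<phi> (\<gamma> n) \<partial>\<nu>) = (\<Sum>\<omega>\<in>atoms (\<F> n). measure \<nu> (cylinder \<F> n \<omega>) *\<^sub>R \<phi> \<omega>)"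
    by (rule part(2)) (erule value_on, erule disjoint, erule cover)
qed

end

section \<open>Summability of the energies of a martingale\<close>

text \<open>
  The increments are given by vectors of \<open>W\<close>, whose entries sum to zero over the children of an
  atom. So the value on an atom is the average of the values on its children, and the values
  weighted by the probabilities of the atoms form an additive vector measure.
\<close>

locale tree_martingale = uniform_tree m M \<F>
  for m :: nat and M :: "'a measure" and \<F> :: "nat \<Rightarrow> 'a measure" +
  fixes J :: "'a set \<Rightarrow> 'm::finite \<Rightarrow> 'a set" and W :: "(real ^ 'l::finite ^ 'm) set"
    and G :: "nat \<Rightarrow> 'a \<Rightarrow> real ^ 'l"
  assumes m_card: "m = CARD('m)"
    and J: "\<And>n \<omega>. \<omega> \<in> atoms (\<F> n) \<Longrightarrow> bij_betw (J \<omega>) UNIV (children \<F> n \<omega>)"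
    and W_zero_sum: "W \<subseteq> zero_sum"
    and G: "G \<in> martingale_space M \<F> J W"
begin

text \<open>
  The norm of the vector measure \<open>\<mu>(\<omega>) = m\<^sup>-\<^sup>n F\<^sub>n(\<omega>)\<close>.
\<close>

definition mass :: "nat \<Rightarrow> 'a set \<Rightarrow> real" where
  "mass n \<omega> = norm (atom_value (G n) \<omega>) / real m ^ n"

text \<open>
  The \<open>\<ell>\<^sub>p\<close> norm of the masses over a level, expressed through the counting measure so that
  Minkowski's inequality for \<open>L\<^sub>p\<close> applies to it.
\<close>

definition energy :: "real \<Rightarrow> nat \<Rightarrow> real" where
  "energy p n = Lp_norm p (count_space (atoms (\<F> n))) (mass n)"

lemma mass_nonneg: "0 \<le> mass n \<omega>"
  by (simp add: mass_def)

lemma G_measurable: "G n \<in> borel_measurable (\<F> n)"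
  and G_bdd: "bdd_above (range (\<lambda>n. \<integral>x. norm (G n x) \<partial>M))"
  and G_increment: "\<omega> \<in> atoms (\<F> n) \<Longrightarrow> \<exists>b\<in>W. \<forall>j. \<forall>x\<in>J \<omega> j. G (Suc n) x - G n x = b $ j"
  using G by (simp_all add: martingale_space_def martingale_def)

lemma J_child: "\<omega> \<in> atoms (\<F> n) \<Longrightarrow> J \<omega> j \<in> children \<F> n \<omega>"
  using bij_betw_apply[OF J UNIV_I] .

lemma sum_mass_Suc:
  "(\<Sum>\<eta>\<in>atoms (\<F> (Suc n)). f (mass (Suc n) \<eta>) :: real)
    = (\<Sum>\<omega>\<in>atoms (\<F> n). \<Sum>j\<in>UNIV. f (mass (Suc n) (J \<omega> j)))"
  unfolding sum_atoms_Suc by (intro sum.cong refl sum.reindex_bij_betw[OF J, symmetric])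

lemma increment_in_W:
  assumes \<omega>: "\<omega> \<in> atoms (\<F> n)"
  shows "\<exists>b\<in>W. \<forall>j. atom_value (G (Suc n)) (J \<omega> j) = atom_value (G n) \<omega> + b $ j"
proof -
  obtain b where "b \<in> W" and b: "\<forall>j. \<forall>x\<in>J \<omega> j. G (Suc n) x - G n x = b $ j"
    using G_increment[OF \<omega>] by (elim bexE)
  have "atom_value (G (Suc n)) (J \<omega> j) = atom_value (G n) \<omega> + b $ j" for j
  proof -
    note \<eta> = childD[OF J_child[OF \<omega>, of j]]
    from ex_in_conv[THEN iffD2, OF atom_nonempty[OF \<eta>(1)]] obtain x where x: "x \<in> J \<omega> j"
      by (elim exE)
    have "atom_value (G (Suc n)) (J \<omega> j) = G (Suc n) x"
      by (rule atom_value_eq[OF G_measurable \<eta>(1) x])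
    moreover have "atom_value (G n) \<omega> = G n x"
      by (rule atom_value_eq[OF G_measurable \<omega> subsetD[OF \<eta>(2) x]])
    moreover have "G (Suc n) x - G n x = b $ j"
      using b x by simp
    ultimately show ?thesis
      by (simp add: algebra_simps)
  qed
  with \<open>b \<in> W\<close> show ?thesis
    by blast
qed

text \<open>
  The triangle inequality: the values on the children average to the value on the atom.
\<close>

lemma mass_le_sum_children:
  assumes \<omega>: "\<omega> \<in> atoms (\<F> n)"
  shows "mass n \<omega> \<le> (\<Sum>j\<in>UNIV. mass (Suc n) (J \<omega> j))"
proof -
  let ?a = "atom_value (G n) \<omega>"
  obtain b where b: "b \<in> W" "\<And>j. atom_value (G (Suc n)) (J \<omega> j) = ?a + b $ j"
    using increment_in_W[OF \<omega>] by metis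
  have "(\<Sum>j\<in>UNIV. b $ j) = 0"
    using b(1) W_zero_sum by (auto simp: zero_sum_def)
  then have "(\<Sum>j\<in>UNIV. ?a + b $ j) = real m *\<^sub>R ?a"
    by (simp only: sum.distrib sum_constant_scaleR add_0_right m_card)
  then have "real m * norm ?a = norm (\<Sum>j\<in>UNIV. ?a + b $ j)"
    by simp
  also have "\<dots> \<le> (\<Sum>j\<in>UNIV. norm (?a + b $ j))"
    by (rule norm_sum)
  finally have "real m * norm ?a / real m ^ Suc n
      \<le> (\<Sum>j\<in>UNIV. norm (?a + b $ j)) / real m ^ Suc n"
    by (rule divide_right_mono) simp
  then show ?thesis
    using m2 by (simp add: mass_def b(2) sum_divide_distrib)
qed

lemma total_mass_le: "(\<Sum>\<omega>\<in>atoms (\<F> n). mass n \<omega>) \<le> martingale_norm M G"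
  unfolding mass_def integral_norm_level[OF G_measurable, symmetric] martingale_norm_def
  by (rule cSUP_upper[OF UNIV_I G_bdd])

lemma Lp_norm_count_le_sum:
  assumes "1 \<le> p" "finite A" "\<And>x. x \<in> A \<Longrightarrow> 0 \<le> f x"
  shows "Lp_norm p (count_space A) f \<le> (\<Sum>x\<in>A. f x :: real)"
proof (rule Lp_norm_leI)
  have "(\<Sum>x\<in>A. f x powr p) \<le> 1 powr (p - 1) * sum f A powr p"
    using assms by (intro sum_powr_le_max) (auto intro: member_le_sum)
  then show "(\<integral>x. norm (f x) powr p \<partial>count_space A) \<le> sum f A powr p"
    using assms by (simp add: lebesgue_integral_count_space_finite)
qed (use assms in \<open>auto intro: sum_nonneg\<close>)

text \<open>
  On each atom the family of the masses of the children has total \<open>T\<close> and, as no child has more than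
  the share \<open>\<theta>\<close>, an \<open>\<ell>\<^sub>p\<close> norm at most \<open>\<theta>\<^bsup>(p-1)/p\<^esup> T\<close>. The total exceeds the mass of the atom by a
  defect \<open>D \<ge> 0\<close>. Minkowski's inequality over the level splits \<open>T\<close> into mass and defect, and the
  \<open>\<ell>\<^sub>p\<close> norm of the defects is at most their sum, the growth of the total mass.
\<close>

lemma energy_step:
  assumes p: "1 < p" and \<theta>: "0 \<le> \<theta>"
    and spread: "\<And>a b j. b \<in> W \<Longrightarrow> norm (a + b $ j) \<le> \<theta> * (\<Sum>i\<in>UNIV. norm (a + b $ i))"
  shows "energy p (Suc n) \<le> \<theta> powr ((p - 1) / p)
    * (energy p n + ((\<Sum>\<omega>\<in>atoms (\<F> (Suc n)). mass (Suc n) \<omega>) - (\<Sum>\<omega>\<in>atoms (\<F> n). mass n \<omega>)))"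
proof -
  let ?A = "atoms (\<F> n)"
  define T where "T = (\<lambda>\<omega>. \<Sum>j\<in>UNIV. mass (Suc n) (J \<omega> j))"
  define D where "D = (\<lambda>\<omega>. T \<omega> - mass n \<omega>)"
  have D0: "0 \<le> D \<omega>" if "\<omega> \<in> ?A" for \<omega>
    using mass_le_sum_children[OF that] by (simp add: D_def T_def)
  have T0: "0 \<le> T \<omega>" for \<omega>
    unfolding T_def by (intro sum_nonneg mass_nonneg)
  have Lp: "f \<in> Lp_space p (count_space (atoms (\<F> k)))" for f :: "'a set \<Rightarrow> real" and k
    by (simp add: Lp_space_def integrable_count_space finite_atoms)
  have spread_atom: "(\<Sum>j\<in>UNIV. mass (Suc n) (J \<omega> j) powr p) \<le> \<theta> powr (p - 1) * T \<omega> powr p"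
    if \<omega>: "\<omega> \<in> ?A" for \<omega>
    unfolding T_def
  proof (rule sum_powr_le_max)
    fix j
    obtain b where b: "b \<in> W" "\<And>j. atom_value (G (Suc n)) (J \<omega> j) = atom_value (G n) \<omega> + b $ j"
      using increment_in_W[OF \<omega>] by metis
    have "norm (atom_value (G n) \<omega> + b $ j) / real m ^ Suc n
        \<le> \<theta> * (\<Sum>i\<in>UNIV. norm (atom_value (G n) \<omega> + b $ i)) / real m ^ Suc n"
      by (intro divide_right_mono spread b(1)) simp
    then show "mass (Suc n) (J \<omega> j) \<le> \<theta> * (\<Sum>i\<in>UNIV. mass (Suc n) (J \<omega> i))"
      by (simp add: mass_def b(2) sum_divide_distrib[symmetric])
  qed (use p \<theta> in \<open>auto simp: mass_nonneg\<close>)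
  have "Lp_norm p (count_space ?A) T = Lp_norm p (count_space ?A) (\<lambda>\<omega>. mass n \<omega> + D \<omega>)"
    by (simp add: D_def)
  also have "\<dots> \<le> energy p n + Lp_norm p (count_space ?A) D"
    unfolding energy_def using p by (intro Lp_minkowski(2) Lp) simp
  also have "\<dots> \<le> energy p n + (\<Sum>\<omega>\<in>?A. D \<omega>)"
    using p D0 by (intro add_left_mono Lp_norm_count_le_sum finite_atoms) auto
  also have "(\<Sum>\<omega>\<in>?A. D \<omega>) = (\<Sum>\<omega>\<in>atoms (\<F> (Suc n)). mass (Suc n) \<omega>) - (\<Sum>\<omega>\<in>?A. mass n \<omega>)"
    using sum_mass_Suc[of "\<lambda>x. x" n] by (simp add: D_def T_def sum_subtractf)
  finally have T_le: "Lp_norm p (count_space ?A) T \<le> energy p n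
      + ((\<Sum>\<omega>\<in>atoms (\<F> (Suc n)). mass (Suc n) \<omega>) - (\<Sum>\<omega>\<in>?A. mass n \<omega>))" .
  have "energy p (Suc n) \<le> \<theta> powr ((p - 1) / p) * Lp_norm p (count_space ?A) T"
    unfolding energy_def
  proof (rule Lp_norm_leI)
    have "(\<integral>\<eta>. norm (mass (Suc n) \<eta>) powr p \<partial>count_space (atoms (\<F> (Suc n))))
        = (\<Sum>\<eta>\<in>atoms (\<F> (Suc n)). mass (Suc n) \<eta> powr p)"
      by (simp add: lebesgue_integral_count_space_finite finite_atoms mass_nonneg)
    also have "\<dots> = (\<Sum>\<omega>\<in>?A. \<Sum>j\<in>UNIV. mass (Suc n) (J \<omega> j) powr p)"
      by (rule sum_mass_Suc)
    also have "\<dots> \<le> (\<Sum>\<omega>\<in>?A. \<theta> powr (p - 1) * T \<omega> powr p)"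
      by (intro sum_mono spread_atom)
    also have "\<dots> = \<theta> powr (p - 1) * Lp_norm p (count_space ?A) T powr p"
      using p T0 by (simp add: Lp_norm_powr lebesgue_integral_count_space_finite finite_atoms sum_distrib_left)
    also have "\<dots> = (\<theta> powr ((p - 1) / p) * Lp_norm p (count_space ?A) T) powr p"
      using p by (simp add: powr_mult powr_powr Lp_norm_nonneg)
    finally show "(\<integral>\<eta>. norm (mass (Suc n) \<eta>) powr p \<partial>count_space (atoms (\<F> (Suc n))))
        \<le> (\<theta> powr ((p - 1) / p) * Lp_norm p (count_space ?A) T) powr p" .
  qed (use p in \<open>auto simp: Lp_norm_nonneg\<close>)
  also have "\<dots> \<le> \<theta> powr ((p - 1) / p) * (energy p n
      + ((\<Sum>\<omega>\<in>atoms (\<F> (Suc n)). mass (Suc n) \<omega>) - (\<Sum>\<omega>\<in>?A. mass n \<omega>)))"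
    by (intro mult_left_mono T_le) simp
  finally show ?thesis .
qed

lemma sum_energy_le:
  assumes p: "1 < p" and \<theta>: "0 \<le> \<theta>" "\<theta> < 1"
    and spread: "\<And>a b j. b \<in> W \<Longrightarrow> norm (a + b $ j) \<le> \<theta> * (\<Sum>i\<in>UNIV. norm (a + b $ i))"
  shows "(\<Sum>n<N. energy p n) \<le> martingale_norm M G / (1 - \<theta> powr ((p - 1) / p))"
proof (rule sum_le_of_contraction[where e = "\<lambda>n. \<Sum>\<omega>\<in>atoms (\<F> n). mass n \<omega>"])
  have "\<theta> powr ((p - 1) / p) < 1 powr ((p - 1) / p)"
    using p \<theta> by (intro powr_less_mono2) auto
  then show "\<theta> powr ((p - 1) / p) < 1"
    by simp
  show "energy p 0 \<le> (\<Sum>\<omega>\<in>atoms (\<F> 0). mass 0 \<omega>)"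
    unfolding energy_def using p by (intro Lp_norm_count_le_sum finite_atoms mass_nonneg) auto
  show "energy p (Suc n) \<le> \<theta> powr ((p - 1) / p) * (energy p n
      + ((\<Sum>\<omega>\<in>atoms (\<F> (Suc n)). mass (Suc n) \<omega>) - (\<Sum>\<omega>\<in>atoms (\<F> n). mass n \<omega>)))" for n
    by (rule energy_step[OF p \<theta>(1) spread])
qed (auto simp: energy_def Lp_norm_nonneg total_mass_le)

text \<open>
  The function lives on finitely many cylinders. By the Frostman condition the \<open>p\<close>-th power of its
  norm receives from the cylinder of \<open>\<omega>\<close> at most
  \<open>(C m\<^bsup>(\<alpha>-1)n\<^esup> m\<^bsup>-\<alpha>n\<^esup> \<parallel>F\<^sub>n(\<omega>)\<parallel>)\<^sup>p\<close>, where the powers of \<open>m\<close> combine to the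
  probability \<open>m\<^sup>-\<^sup>n\<close> of \<open>\<omega>\<close>.
\<close>

lemma trace_level:
  fixes \<nu> :: "(nat \<Rightarrow> 'a set) measure"
  assumes p: "1 < p" and \<nu>: "finite_measure \<nu>" "sets \<nu> = sets (path_borel m \<F>)" and C: "0 \<le> C"
    and frostman: "\<And>\<omega>. \<omega> \<in> atoms (\<F> n) \<Longrightarrow>
      measure \<nu> (cylinder \<F> n \<omega>) powr (1 / p) \<le> C * real m powr ((\<alpha> - 1) * real n)"
  defines "h \<equiv> \<lambda>\<gamma>. real m powr - (\<alpha> * real n) *\<^sub>R atom_value (G n) (\<gamma> n)"
  shows "h \<in> Lp_space p \<nu>" and "Lp_norm p \<nu> h \<le> C * energy p n"
proof -
  let ?m = "real m" and ?A = "atoms (\<F> n)"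
  define \<psi> where "\<psi> = (\<lambda>\<omega>. ?m powr - (\<alpha> * real n) *\<^sub>R atom_value (G n) \<omega>)"
  have h: "h = (\<lambda>\<gamma>. \<psi> (\<gamma> n))"
    by (simp add: h_def \<psi>_def)
  note int_h = integral_paths_level(1)[OF \<nu>, of \<psi> n]
    and int_pow = integral_paths_level[OF \<nu>, of "\<lambda>\<omega>. norm (\<psi> \<omega>) powr p" n]
  show "h \<in> Lp_space p \<nu>"
    unfolding h Lp_space_def using int_h int_pow(1) by (simp add: borel_measurable_integrable)
  have le: "measure \<nu> (cylinder \<F> n \<omega>) *\<^sub>R norm (\<psi> \<omega>) powr p \<le> C powr p * mass n \<omega> powr p"
    if \<omega>: "\<omega> \<in> ?A" for \<omega>
  proof -
    have "measure \<nu> (cylinder \<F> n \<omega>) = (measure \<nu> (cylinder \<F> n \<omega>) powr (1 / p)) powr p"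
      using p by (simp add: powr_powr)
    also have "\<dots> \<le> (C * ?m powr ((\<alpha> - 1) * real n)) powr p"
      using frostman[OF \<omega>] p by (intro powr_mono2) auto
    finally have "measure \<nu> (cylinder \<F> n \<omega>) * norm (\<psi> \<omega>) powr p
        \<le> (C * ?m powr ((\<alpha> - 1) * real n)) powr p * norm (\<psi> \<omega>) powr p"
      by (rule mult_right_mono) simp
    also have "\<dots> = (C * (?m powr ((\<alpha> - 1) * real n) * norm (\<psi> \<omega>))) powr p"
      using C by (simp add: powr_mult)
    also have "?m powr ((\<alpha> - 1) * real n) * norm (\<psi> \<omega>)
        = ?m powr ((\<alpha> - 1) * real n + - (\<alpha> * real n)) * norm (atom_value (G n) \<omega>)"
      by (simp only: \<psi>_def norm_scaleR powr_add abs_of_nonneg[OF powr_ge_zero] mult.assoc)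
    also have "(\<alpha> - 1) * real n + - (\<alpha> * real n) = - real n"
      by (simp add: algebra_simps)
    also have "?m powr - real n * norm (atom_value (G n) \<omega>) = mass n \<omega>"
      using m2 by (simp add: mass_def powr_minus powr_realpow divide_simps)
    also have "(C * mass n \<omega>) powr p = C powr p * mass n \<omega> powr p"
      using C mass_nonneg by (simp add: powr_mult)
    finally show ?thesis
      by simp
  qed
  show "Lp_norm p \<nu> h \<le> C * energy p n"
  proof (rule Lp_norm_leI)
    have "(\<integral>\<gamma>. norm (h \<gamma>) powr p \<partial>\<nu>) \<le> (\<Sum>\<omega>\<in>?A. C powr p * mass n \<omega> powr p)"
      unfolding h int_pow(2) by (intro sum_mono le)
    also have "\<dots> = C powr p * energy p n powr p"
      using p by (simp add: energy_def Lp_norm_powr lebesgue_integral_count_space_finite finite_atoms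
          mass_nonneg sum_distrib_left)
    also have "\<dots> = (C * energy p n) powr p"
      using C by (simp add: powr_mult energy_def Lp_norm_nonneg)
    finally show "(\<integral>\<gamma>. norm (h \<gamma>) powr p \<partial>\<nu>) \<le> (C * energy p n) powr p" .
  qed (use p C in \<open>auto simp: energy_def Lp_norm_nonneg\<close>)
qed

text \<open>
  The terms of the series are differences of two consecutive functions \<open>h\<^sub>n = m\<^bsup>-\<alpha>n\<^esup> F\<^sub>n\<close>, the
  earlier one multiplied by \<open>m\<^sup>-\<^sup>\<alpha>\<close>, and the norms of the \<open>h\<^sub>n\<close> are summable.
\<close>

lemma riesz_trace:
  fixes \<nu> :: "(nat \<Rightarrow> 'a set) measure"
  assumes p: "1 < p" and \<theta>: "0 \<le> \<theta>" "\<theta> < 1"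
    and spread: "\<And>a b j. b \<in> W \<Longrightarrow> norm (a + b $ j) \<le> \<theta> * (\<Sum>i\<in>UNIV. norm (a + b $ i))"
    and \<nu>: "finite_measure \<nu>" "sets \<nu> = sets (path_borel m \<F>)" and C: "0 \<le> C"
    and frostman: "\<And>n \<omega>. \<omega> \<in> atoms (\<F> n) \<Longrightarrow>
      measure \<nu> (cylinder \<F> n \<omega>) powr (1 / p) \<le> C * real m powr ((\<alpha> - 1) * real n)"
  defines "B \<equiv> C * (1 + real m powr - \<alpha>) / (1 - \<theta> powr ((p - 1) / p)) * martingale_norm M G"
  shows "\<exists>g. Lp_converges p \<nu> (riesz_partial_sum m \<alpha> G) g"
    and "Lp_norm p \<nu> (riesz_partial_sum m \<alpha> G N) \<le> B"
proof -
  let ?m = "real m"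
  define h where "h = (\<lambda>n \<gamma>. ?m powr - (\<alpha> * real n) *\<^sub>R atom_value (G n) (\<gamma> n))"
  define u where "u = (\<lambda>n \<gamma>. h (Suc n) \<gamma> - ?m powr - \<alpha> *\<^sub>R h n \<gamma>)"
  have p1: "1 \<le> p" and p0: "0 < p"
    using p by auto
  have h: "h n \<in> Lp_space p \<nu>" "Lp_norm p \<nu> (h n) \<le> C * energy p n" for n
    unfolding h_def by (rule trace_level[OF p \<nu> C frostman], assumption)+
  have partial: "riesz_partial_sum m \<alpha> G = (\<lambda>N \<gamma>. \<Sum>n<N. u n \<gamma>)"
  proof (intro ext)
    fix N \<gamma>
    have "?m powr - (\<alpha> * real (Suc n)) *\<^sub>R (atom_value (G (Suc n)) (\<gamma> (Suc n)) - atom_value (G n) (\<gamma> n)) = u n \<gamma>" for n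
    proof -
      have "- (\<alpha> * real (Suc n)) = - \<alpha> + - (\<alpha> * real n)"
        by (simp add: algebra_simps)
      then have "?m powr - (\<alpha> * real (Suc n)) = ?m powr - \<alpha> * ?m powr - (\<alpha> * real n)"
        by (simp only: powr_add)
      then show ?thesis
        by (simp only: u_def h_def scaleR_diff_right scaleR_scaleR)
    qed
    then show "riesz_partial_sum m \<alpha> G N \<gamma> = (\<Sum>n<N. u n \<gamma>)"
      by (simp only: riesz_partial_sum_def on_paths_eq_atom_value sum.atLeast1_atMost_eq One_nat_def diff_Suc_Suc diff_zero)
  qed
  have u: "u n \<in> Lp_space p \<nu>" for n
    unfolding u_def by (intro Lp_diff(1)[OF p1] Lp_space_scaleR h(1))
  have u_norm: "Lp_norm p \<nu> (u n) \<le> C * (energy p (Suc n) + ?m powr - \<alpha> * energy p n)" for n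
  proof -
    have "Lp_norm p \<nu> (u n) \<le> Lp_norm p \<nu> (h (Suc n)) + Lp_norm p \<nu> (\<lambda>\<gamma>. ?m powr - \<alpha> *\<^sub>R h n \<gamma>)"
      unfolding u_def by (intro Lp_diff(2)[OF p1] Lp_space_scaleR h(1))
    also have "\<dots> \<le> C * energy p (Suc n) + ?m powr - \<alpha> * (C * energy p n)"
      unfolding Lp_norm_scaleR[OF p0] by (intro add_mono h(2) mult_mono) (auto simp: Lp_norm_nonneg)
    finally show ?thesis
      by (simp add: algebra_simps)
  qed
  have sum_u: "(\<Sum>n<N. Lp_norm p \<nu> (u n)) \<le> B" for N
  proof -
    let ?E = "martingale_norm M G / (1 - \<theta> powr ((p - 1) / p))"
    note E = sum_energy_le[OF p \<theta> spread]
    have e0: "0 \<le> energy p 0"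
      by (simp add: energy_def Lp_norm_nonneg)
    have "(\<Sum>n<N. energy p (Suc n)) \<le> (\<Sum>n<Suc N. energy p n)"
      unfolding sum.lessThan_Suc_shift using e0 by simp
    also have "\<dots> \<le> ?E"
      by (rule E)
    finally have shifted: "(\<Sum>n<N. energy p (Suc n)) \<le> ?E" .
    have "(\<Sum>n<N. Lp_norm p \<nu> (u n)) \<le> (\<Sum>n<N. C * (energy p (Suc n) + ?m powr - \<alpha> * energy p n))"
      by (intro sum_mono u_norm)
    also have "\<dots> = C * ((\<Sum>n<N. energy p (Suc n)) + ?m powr - \<alpha> * (\<Sum>n<N. energy p n))"
      by (simp only: sum_distrib_left[symmetric] sum.distrib)
    also have "\<dots> \<le> C * (?E + ?m powr - \<alpha> * ?E)"
      by (intro mult_left_mono add_mono shifted E C) simp_all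
    also have "\<dots> = B"
      by (simp add: B_def algebra_simps add_divide_distrib)
    finally show ?thesis .
  qed
  have "summable (\<lambda>n. Lp_norm p \<nu> (u n))"
    by (rule summableI_nonneg_bounded[OF Lp_norm_nonneg sum_u])
  then show "\<exists>g. Lp_converges p \<nu> (riesz_partial_sum m \<alpha> G) g"
    unfolding partial by (rule Lp_converges_series[OF p1 u])
  have "Lp_norm p \<nu> (\<lambda>\<gamma>. \<Sum>n<N. u n \<gamma>) \<le> (\<Sum>n<N. Lp_norm p \<nu> (u n))"
    using Lp_minkowski_sum[OF p1 finite_lessThan, of N u \<nu>] u by simp
  also have "\<dots> \<le> B"
    by (rule sum_u)
  finally show "Lp_norm p \<nu> (riesz_partial_sum m \<alpha> G N) \<le> B"
    unfolding partial .
qed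

end

section \<open>Continuity of the Riesz potential\<close>

theorem theorem6p1:
  fixes M :: "'a measure"
    and \<F> :: "nat \<Rightarrow> 'a measure"
    and J :: "'a set \<Rightarrow> 'm::finite \<Rightarrow> 'a set"
    and W :: "(real ^ 'l::finite ^ 'm) set"
    and \<nu> :: "(nat \<Rightarrow> 'a set) measure"
    and \<alpha> p :: real
  assumes "CARD('m) \<ge> 3"
    and "m_uniform_filtration CARD('m) M \<F>"
    and "\<And>n \<omega>. \<omega> \<in> atoms (\<F> n) \<Longrightarrow> bij_betw (J \<omega>) UNIV (children \<F> n \<omega>)"
    and "subspace W" and "W \<subseteq> zero_sum"
    and "second_structural_condition W"
    and "1 < p"
    and "finite_measure \<nu>" and "sets \<nu> = sets (path_borel CARD('m) \<F>)"
    and "frostman_condition CARD('m) \<F> \<alpha> p \<nu>"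
  shows "riesz_potential_continuous CARD('m) M (martingale_space M \<F> J W) \<alpha> p \<nu>"
proof -
  have card2: "2 \<le> CARD('m)"
    using assms(1) by simp
  obtain \<theta> where \<theta>: "0 \<le> \<theta>" "\<theta> < 1"
    and spread: "\<And>a b j. b \<in> W \<Longrightarrow> norm (a + b $ j) \<le> \<theta> * (\<Sum>i\<in>UNIV. norm (a + b $ i))"
    using second_structural_max_bound[OF assms(4,5,6) card2] by (metis less_imp_le)
  obtain C where C: "\<forall>n. \<forall>\<omega>\<in>atoms (\<F> n).
      measure \<nu> (cylinder \<F> n \<omega>) powr (1 / p) \<le> C * real CARD('m) powr ((\<alpha> - 1) * real n)"
    using assms(10) unfolding frostman_condition_def by blast
  \<comment> \<open>The sign of the constant is not prescribed, and the estimates multiply by it.\<close>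
  have frostman: "measure \<nu> (cylinder \<F> n \<omega>) powr (1 / p) \<le> \<bar>C\<bar> * real CARD('m) powr ((\<alpha> - 1) * real n)"
    if "\<omega> \<in> atoms (\<F> n)" for n \<omega>
  proof -
    have "measure \<nu> (cylinder \<F> n \<omega>) powr (1 / p) \<le> C * real CARD('m) powr ((\<alpha> - 1) * real n)"
      using C that by blast
    also have "\<dots> \<le> \<bar>C\<bar> * real CARD('m) powr ((\<alpha> - 1) * real n)"
      by (intro mult_right_mono) auto
    finally show ?thesis .
  qed
  have tree: "tree_martingale CARD('m) M \<F> J W F" if "F \<in> martingale_space M \<F> J W" for F
    by (intro tree_martingale.intro uniform_tree.intro tree_martingale_axioms.intro assms(2,3,5) card2 that refl)
  note trace = tree_martingale.riesz_trace[OF tree assms(7) \<theta> spread assms(8,9) abs_ge_zero frostman]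
  show ?thesis
    unfolding riesz_potential_continuous_def
  proof (intro conjI)
    show "\<forall>F\<in>martingale_space M \<F> J W. \<exists>g. Lp_converges p \<nu> (riesz_partial_sum CARD('m) \<alpha> F) g"
      by (rule ballI) (rule trace(1))
    show "\<exists>K. \<forall>F\<in>martingale_space M \<F> J W. \<forall>g. Lp_converges p \<nu> (riesz_partial_sum CARD('m) \<alpha> F) g
        \<longrightarrow> Lp_norm p \<nu> g \<le> K * martingale_norm M F"
    proof (intro exI ballI allI impI)
      fix F g assume F: "F \<in> martingale_space M \<F> J W"
        and "Lp_converges p \<nu> (riesz_partial_sum CARD('m) \<alpha> F) g"
      then show "Lp_norm p \<nu> g
          \<le> \<bar>C\<bar> * (1 + real CARD('m) powr - \<alpha>) / (1 - \<theta> powr ((p - 1) / p)) * martingale_norm M F"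
        using Lp_norm_limit_le[OF less_imp_le[OF assms(7)] _ trace(2)[OF F]] by simp
    qed
  qed
qed

end
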